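(* Let $G$ be a compact abelian Lie group. Each trivial NCP $G$-bundle $(A,G,\alpha)$ carries the structure of a NCP $G$-bundle, i.e. the dynamical system $(A,G,\alpha)$ is itself a NCP $G$-bundle.
   Context: A dynamical system $(A,G,\alpha)$ consists of a unital locally convex $\mathbb{C}$-algebra $A$ (jointly continuous multiplication), the topological group $G$ and a homomorphism $\alpha:G\to\operatorname{Aut}(A)$ such that $(g,a)\mapsto\alpha(g)(a)$ is continuous on $G\times A$. Trivial NCP $G$-bundles: write $G\cong\mathbb{T}^n\times\Lambda$ with $\Lambda=C_{n_1}\times\cdots\times C_{n_k}$ finite abelian, $C_m$ the group of $m$-th roots of unity; then $\widehat{G}\cong\mathbb{Z}^n\times\Lambda$. For a character $\varphi\in\widehat{G}$ let $A_\varphi=\{a\in A:\alpha(g)(a)=\varphi(g)a\ \forall g\in G\}$. A dynamical system $(A,G,\alpha)$ is a trivial NCP $G$-bundle if (G1) each $A_\varphi$ with $\varphi$ in the $\mathbb{Z}^n$-part of $\widehat{G}$ contains an invertible element of $A$; (G2) for each $i=1,\dots,k$, with $A_i$ the isotypic component for the $i$-th standard generator (the character $(z,(w_1,\dots,w_k))\mapsto w_i$) of the $\Lambda$-part, there exist an invertible $a_i\in A_i$ and an element $b_i$ of the fixed point algebra $A^G$ with $b_i^{n_i}=a_i^{n_i}$. Localization: let $C_A$ be the center of $A$ and $Z:=C_A^G$ the fixed points of $G$ in $C_A$. For $z\in Z$ let $A_{\{z\}}:=C^{\infty}(\mathbb{R},A)/I_z$, where $C^\infty(\mathbb{R},A)$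 carries the smooth compact open topology (uniform convergence of all derivatives on compact sets) and $I_z$ is the closure of the two-sided ideal generated by $t\mapsto1_A-tz$; $G$ acts by $\alpha_{\{z\}}(g)[f]:=[\alpha(g)\circ f]$. Let $\Gamma_Z$ be the set of nonzero algebra homomorphisms $Z\to\mathbb{C}$. $(A,G,\alpha)$ is a NCP $G$-bundle if for each $\chi\in\Gamma_Z$ there exists $z\in Z$ with $\chi(z)\neq0$ such that $(A_{\{z\}},G,\alpha_{\{z\}})$ is a trivial NCP $G$-bundle. *)

theory Defs
  imports
    "HOL-Analysis.Analysis"
    "HOL-Algebra.Module"
    "HOL-Algebra.QuotRing"
    "HOL-Algebra.Product_Groups"
begin

text \<open>
  The localization of an algebra is a quotient of a function algebra by an ideal that depends on an
  element of the algebra, so groups and algebras are treated as records with explicit carriers and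
  explicit (abstract) topologies.
\<close>

section \<open>Topological groups and compact abelian Lie groups\<close>

record 'g top_group = "'g monoid" +
  gtop :: "'g topology"

definition topological_group :: "'g top_group \<Rightarrow> bool" where
  "topological_group G \<longleftrightarrow>
     group G \<and> topspace (gtop G) = carrier G \<and>
     continuous_map (prod_topology (gtop G) (gtop G)) (gtop G) (\<lambda>(x, y). x \<otimes>\<^bsub>G\<^esub> y) \<and>
     continuous_map (gtop G) (gtop G) (\<lambda>x. inv\<^bsub>G\<^esub> x)"

text \<open>
  Points of \<open>\<real>\<^sup>d\<close> are the functions \<^term>\<open>x :: nat \<Rightarrow> real\<close> that vanish from index \<open>d\<close> on, as in
  \<^const>\<open>Euclidean_space\<close>. This covers \<open>d = 0\<close>, which is the case of finite groups. In
  \<open>Ck_on d k U f\<close> the set \<open>U\<close> is meant to be open in \<open>\<real>\<^sup>d\<close>, and \<open>f\<close> is \<open>C\<^sup>k\<close> on it iff its iterated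
  partial derivatives up to order \<open>k\<close> exist and are continuous.
\<close>

primrec Ck_on :: "nat \<Rightarrow> nat \<Rightarrow> (nat \<Rightarrow> real) set \<Rightarrow> ((nat \<Rightarrow> real) \<Rightarrow> real) \<Rightarrow> bool" where
  "Ck_on d 0 U f \<longleftrightarrow> continuous_map (subtopology (Euclidean_space d) U) euclideanreal f"
| "Ck_on d (Suc k) U f \<longleftrightarrow>
     continuous_map (subtopology (Euclidean_space d) U) euclideanreal f \<and>
     (\<forall>i<d. \<exists>g. (\<forall>x\<in>U. ((\<lambda>s. f (x(i := s))) has_real_derivative g x) (at (x i))) \<and> Ck_on d k U g)"

definition smooth_map_on ::
  "nat \<Rightarrow> nat \<Rightarrow> (nat \<Rightarrow> real) set \<Rightarrow> ((nat \<Rightarrow> real) \<Rightarrow> nat \<Rightarrow> real) \<Rightarrow> bool" where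
  "smooth_map_on d e U F \<longleftrightarrow> (\<forall>j<e. \<forall>k. Ck_on d k U (\<lambda>x. F x j))"

definition chart :: "nat \<Rightarrow> 'g topology \<Rightarrow> 'g set \<Rightarrow> ('g \<Rightarrow> nat \<Rightarrow> real) \<Rightarrow> bool" where
  "chart d X U c \<longleftrightarrow> openin X U \<and> openin (Euclidean_space d) (c ` U) \<and>
     homeomorphic_map (subtopology X U) (subtopology (Euclidean_space d) (c ` U)) c"

definition smooth_atlas :: "nat \<Rightarrow> 'g topology \<Rightarrow> ('g set \<times> ('g \<Rightarrow> nat \<Rightarrow> real)) set \<Rightarrow> bool" where
  "smooth_atlas d X \<A> \<longleftrightarrow>
     (\<forall>(U, c)\<in>\<A>. chart d X U c) \<and>
     (\<Union>(U, c)\<in>\<A>. U) = topspace X \<and>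
     (\<forall>(U, c)\<in>\<A>. \<forall>(V, e)\<in>\<A>. smooth_map_on d d (c ` (U \<inter> V)) (\<lambda>x. e (inv_into U c x)))"

text \<open>The two components of a point of \<open>\<real>\<^sup>d \<times> \<real>\<^sup>d = \<real>\<^bsup>d+d\<^esup>\<close>.\<close>

definition fst_half :: "nat \<Rightarrow> (nat \<Rightarrow> real) \<Rightarrow> nat \<Rightarrow> real" where
  "fst_half d x = (\<lambda>i. if i < d then x i else 0)"

definition snd_half :: "nat \<Rightarrow> (nat \<Rightarrow> real) \<Rightarrow> nat \<Rightarrow> real" where
  "snd_half d x = (\<lambda>i. if i < d then x (d + i) else 0)"

definition lie_group :: "'g top_group \<Rightarrow> bool" where
  "lie_group G \<longleftrightarrow>
     topological_group G \<and> Hausdorff_space (gtop G) \<and> second_countable (gtop G) \<and>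
     (\<exists>d \<A>. smooth_atlas d (gtop G) \<A> \<and>
       (\<forall>(U, a)\<in>\<A>. \<forall>(V, b)\<in>\<A>. \<forall>(W, c)\<in>\<A>.
          smooth_map_on (d + d) d
            {x \<in> topspace (Euclidean_space (d + d)). fst_half d x \<in> a ` U \<and> snd_half d x \<in> b ` V \<and>
               inv_into U a (fst_half d x) \<otimes>\<^bsub>G\<^esub> inv_into V b (snd_half d x) \<in> W}
            (\<lambda>x. c (inv_into U a (fst_half d x) \<otimes>\<^bsub>G\<^esub> inv_into V b (snd_half d x)))) \<and>
       (\<forall>(U, a)\<in>\<A>. \<forall>(V, b)\<in>\<A>.
          smooth_map_on d d {x \<in> a ` U. inv\<^bsub>G\<^esub> (inv_into U a x) \<in> V}
            (\<lambda>x. b (inv\<^bsub>G\<^esub> (inv_into U a x)))))"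

definition compact_abelian_lie_group :: "'g top_group \<Rightarrow> bool" where
  "compact_abelian_lie_group G \<longleftrightarrow> lie_group G \<and> compact_space (gtop G) \<and> comm_group G"

definition circle_group :: "complex monoid" where
  "circle_group = \<lparr>carrier = sphere 0 1, mult = (*), one = 1\<rparr>"

definition roots_of_unity_group :: "nat \<Rightarrow> complex monoid" where
  "roots_of_unity_group m = \<lparr>carrier = {w. w ^ m = 1}, mult = (*), one = 1\<rparr>"

text \<open>
  \<open>standard_form n ns \<Phi> G\<close>: the map \<open>\<Phi>\<close> is an isomorphism of topological groups from \<open>G\<close> onto
  \<open>\<T>\<^sup>n \<times> C\<^bsub>ns ! 0\<^esub> \<times> \<dots> \<times> C\<^bsub>ns ! (k - 1)\<^esub>\<close>, where \<open>k = length ns\<close>. By the structure theorem every compact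
  abelian Lie group has such an identification. It is not unique, and the notions below refer to
  a chosen one.
\<close>

definition standard_form ::
  "nat \<Rightarrow> nat list \<Rightarrow> ('g \<Rightarrow> (nat \<Rightarrow> complex) \<times> (nat \<Rightarrow> complex)) \<Rightarrow> 'g top_group \<Rightarrow> bool" where
  "standard_form n ns \<Phi> G \<longleftrightarrow>
     (\<forall>m\<in>set ns. m > 0) \<and>
     \<Phi> \<in> iso G (product_group {..<n} (\<lambda>_. circle_group) \<times>\<times>
                product_group {..<length ns} (\<lambda>j. roots_of_unity_group (ns ! j))) \<and>
     homeomorphic_map (gtop G)
       (prod_topology
          (product_topology (\<lambda>_. top_of_set (sphere 0 1)) {..<n})
          (product_topology (\<lambda>j. top_of_set {w. w ^ (ns ! j) = 1}) {..<length ns})) \<Phi>"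

text \<open>
  The character of \<open>G\<close> for \<open>m \<in> \<int>\<^sup>n\<close>, i.e. \<open>(z, w) \<mapsto> z\<^sub>0\<^bsup>m 0\<^esup> \<cdots> z\<^bsub>n-1\<^esub>\<^bsup>m (n-1)\<^esup>\<close>, and the
  \<open>j\<close>-th standard generator \<open>(z, w) \<mapsto> w\<^sub>j\<close> of the finite part of the dual group.
\<close>

definition torus_character ::
  "nat \<Rightarrow> ('g \<Rightarrow> (nat \<Rightarrow> complex) \<times> (nat \<Rightarrow> complex)) \<Rightarrow> (nat \<Rightarrow> int) \<Rightarrow> 'g \<Rightarrow> complex" where
  "torus_character n \<Phi> m g = (\<Prod>i<n. fst (\<Phi> g) i powi m i)"

definition finite_character ::
  "('g \<Rightarrow> (nat \<Rightarrow> complex) \<times> (nat \<Rightarrow> complex)) \<Rightarrow> nat \<Rightarrow> 'g \<Rightarrow> complex" where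
  "finite_character \<Phi> j g = snd (\<Phi> g) j"


section \<open>Locally convex algebras\<close>

definition complex_ring :: "complex ring" where
  "complex_ring = \<lparr>carrier = UNIV, mult = (*), one = 1, zero = 0, add = (+)\<rparr>"

record 'a top_algebra = "(complex, 'a) module" +
  atop :: "'a topology"

definition complex_algebra :: "'a top_algebra \<Rightarrow> bool" where
  "complex_algebra A \<longleftrightarrow> ring A \<and> module complex_ring A \<and>
     (\<forall>c. \<forall>x\<in>carrier A. \<forall>y\<in>carrier A.
        (c \<odot>\<^bsub>A\<^esub> x) \<otimes>\<^bsub>A\<^esub> y = c \<odot>\<^bsub>A\<^esub> (x \<otimes>\<^bsub>A\<^esub> y) \<and> x \<otimes>\<^bsub>A\<^esub> (c \<odot>\<^bsub>A\<^esub> y) = c \<odot>\<^bsub>A\<^esub> (x \<otimes>\<^bsub>A\<^esub> y))"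

text \<open>
  Unital (the \<^locale>\<open>ring\<close> locale includes a unit) and not necessarily commutative. As usual for
  differential calculus, locally convex spaces are Hausdorff; derivatives are then unique.
\<close>

definition locally_convex_algebra :: "'a top_algebra \<Rightarrow> bool" where
  "locally_convex_algebra A \<longleftrightarrow>
     complex_algebra A \<and> topspace (atop A) = carrier A \<and> Hausdorff_space (atop A) \<and>
     continuous_map (prod_topology (atop A) (atop A)) (atop A) (\<lambda>(x, y). x \<oplus>\<^bsub>A\<^esub> y) \<and>
     continuous_map (prod_topology euclidean (atop A)) (atop A) (\<lambda>(c, x). c \<odot>\<^bsub>A\<^esub> x) \<and>
     continuous_map (prod_topology (atop A) (atop A)) (atop A) (\<lambda>(x, y). x \<otimes>\<^bsub>A\<^esub> y) \<and>
     (\<forall>U. openin (atop A) U \<and> \<zero>\<^bsub>A\<^esub> \<in> U \<longrightarrow>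
       (\<exists>V. openin (atop A) V \<and> \<zero>\<^bsub>A\<^esub> \<in> V \<and> V \<subseteq> U \<and>
          (\<forall>x\<in>V. \<forall>y\<in>V. \<forall>r\<in>{0..1}.
             complex_of_real (1 - r) \<odot>\<^bsub>A\<^esub> x \<oplus>\<^bsub>A\<^esub> complex_of_real r \<odot>\<^bsub>A\<^esub> y \<in> V)))"

definition algebra_aut :: "'a top_algebra \<Rightarrow> ('a \<Rightarrow> 'a) set" where
  "algebra_aut A =
     {h \<in> ring_iso A A. \<forall>c. \<forall>x\<in>carrier A. h (c \<odot>\<^bsub>A\<^esub> x) = c \<odot>\<^bsub>A\<^esub> h x}"


section \<open>Dynamical systems and trivial NCP bundles\<close>

text \<open>
  Bicontinuity of each single \<open>\<alpha> g\<close> is a consequence of the joint continuity of the action.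
\<close>

definition dynamical_system :: "'a top_algebra \<Rightarrow> 'g top_group \<Rightarrow> ('g \<Rightarrow> 'a \<Rightarrow> 'a) \<Rightarrow> bool" where
  "dynamical_system A G \<alpha> \<longleftrightarrow>
     locally_convex_algebra A \<and> topological_group G \<and>
     (\<forall>g\<in>carrier G. \<alpha> g \<in> algebra_aut A) \<and>
     (\<forall>g\<in>carrier G. \<forall>h\<in>carrier G. \<forall>a\<in>carrier A. \<alpha> (g \<otimes>\<^bsub>G\<^esub> h) a = \<alpha> g (\<alpha> h a)) \<and>
     continuous_map (prod_topology (gtop G) (atop A)) (atop A) (\<lambda>(g, a). \<alpha> g a)"

definition isotypic ::
  "'a top_algebra \<Rightarrow> 'g top_group \<Rightarrow> ('g \<Rightarrow> 'a \<Rightarrow> 'a) \<Rightarrow> ('g \<Rightarrow> complex) \<Rightarrow> 'a set" where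
  "isotypic A G \<alpha> \<phi> = {a \<in> carrier A. \<forall>g\<in>carrier G. \<alpha> g a = \<phi> g \<odot>\<^bsub>A\<^esub> a}"

definition fixed_points :: "'a top_algebra \<Rightarrow> 'g top_group \<Rightarrow> ('g \<Rightarrow> 'a \<Rightarrow> 'a) \<Rightarrow> 'a set" where
  "fixed_points A G \<alpha> = {a \<in> carrier A. \<forall>g\<in>carrier G. \<alpha> g a = a}"

definition trivial_ncp_bundle ::
  "nat \<Rightarrow> nat list \<Rightarrow> ('g \<Rightarrow> (nat \<Rightarrow> complex) \<times> (nat \<Rightarrow> complex)) \<Rightarrow>
   'a top_algebra \<Rightarrow> 'g top_group \<Rightarrow> ('g \<Rightarrow> 'a \<Rightarrow> 'a) \<Rightarrow> bool" where
  "trivial_ncp_bundle n ns \<Phi> A G \<alpha> \<longleftrightarrow>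
     dynamical_system A G \<alpha> \<and>
     (\<forall>m. isotypic A G \<alpha> (torus_character n \<Phi> m) \<inter> Units A \<noteq> {}) \<and>
     (\<forall>j<length ns. \<exists>a \<in> isotypic A G \<alpha> (finite_character \<Phi> j) \<inter> Units A.
        \<exists>b \<in> fixed_points A G \<alpha>. b [^]\<^bsub>A\<^esub> (ns ! j) = a [^]\<^bsub>A\<^esub> (ns ! j))"


section \<open>Smooth curves with values in a locally convex algebra\<close>

definition has_curve_deriv :: "'a top_algebra \<Rightarrow> (real \<Rightarrow> 'a) \<Rightarrow> 'a \<Rightarrow> real \<Rightarrow> bool" where
  "has_curve_deriv A f l t \<longleftrightarrow>
     limitin (atop A) (\<lambda>h. complex_of_real (1 / h) \<odot>\<^bsub>A\<^esub> (f (t + h) \<ominus>\<^bsub>A\<^esub> f t)) l (at 0)"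

definition curve_deriv :: "'a top_algebra \<Rightarrow> (real \<Rightarrow> 'a) \<Rightarrow> real \<Rightarrow> 'a" where
  "curve_deriv A f t = (THE l. has_curve_deriv A f l t)"

definition smooth_curves :: "'a top_algebra \<Rightarrow> (real \<Rightarrow> 'a) set" where
  "smooth_curves A =
     {f. range f \<subseteq> carrier A \<and> (\<forall>k t. \<exists>l. has_curve_deriv A ((curve_deriv A ^^ k) f) l t)}"

text \<open>Curves \<open>V\<close>-close to \<open>f\<close> on \<open>K\<close> together with all derivatives of order at most \<open>m\<close>.\<close>

definition smooth_nhd ::
  "'a top_algebra \<Rightarrow> (real \<Rightarrow> 'a) \<Rightarrow> real set \<Rightarrow> nat \<Rightarrow> 'a set \<Rightarrow> (real \<Rightarrow> 'a) set" where
  "smooth_nhd A f K m V =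
     {g \<in> smooth_curves A. \<forall>k\<le>m. \<forall>t\<in>K.
        (curve_deriv A ^^ k) g t \<ominus>\<^bsub>A\<^esub> (curve_deriv A ^^ k) f t \<in> V}"

definition smooth_compact_open :: "'a top_algebra \<Rightarrow> (real \<Rightarrow> 'a) topology" where
  "smooth_compact_open A = topology (\<lambda>U. U \<subseteq> smooth_curves A \<and>
     (\<forall>f\<in>U. \<exists>K m V. compact K \<and> openin (atop A) V \<and> \<zero>\<^bsub>A\<^esub> \<in> V \<and> smooth_nhd A f K m V \<subseteq> U))"

lemma smooth_nhd_mono:
  assumes "K' \<subseteq> K" "m' \<le> m" "V \<subseteq> V'"
  shows "smooth_nhd A f K m V \<subseteq> smooth_nhd A f K' m' V'"
  using assms unfolding smooth_nhd_def by fastforce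

lemma openin_smooth_compact_open:
  "openin (smooth_compact_open A) U \<longleftrightarrow> U \<subseteq> smooth_curves A \<and>
     (\<forall>f\<in>U. \<exists>K m V. compact K \<and> openin (atop A) V \<and> \<zero>\<^bsub>A\<^esub> \<in> V \<and> smooth_nhd A f K m V \<subseteq> U)"
proof -
  let ?P = "\<lambda>U. U \<subseteq> smooth_curves A \<and>
     (\<forall>f\<in>U. \<exists>K m V. compact K \<and> openin (atop A) V \<and> \<zero>\<^bsub>A\<^esub> \<in> V \<and> smooth_nhd A f K m V \<subseteq> U)"
  have "istopology ?P"
    unfolding istopology_def
  proof (intro conjI allI impI)
    fix S T assume S: "?P S" and T: "?P T"
    show "S \<inter> T \<subseteq> smooth_curves A" using S by blast
    show "\<forall>f\<in>S \<inter> T. \<exists>K m V. compact K \<and> openin (atop A) V \<and> \<zero>\<^bsub>A\<^esub> \<in> V \<and>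
            smooth_nhd A f K m V \<subseteq> S \<inter> T"
    proof
      fix f assume "f \<in> S \<inter> T"
      then obtain K m V K' m' V' where
        1: "compact K" "openin (atop A) V" "\<zero>\<^bsub>A\<^esub> \<in> V" "smooth_nhd A f K m V \<subseteq> S" and
        2: "compact K'" "openin (atop A) V'" "\<zero>\<^bsub>A\<^esub> \<in> V'" "smooth_nhd A f K' m' V' \<subseteq> T"
        using S T by (meson IntD1 IntD2)
      have "smooth_nhd A f (K \<union> K') (max m m') (V \<inter> V') \<subseteq> S \<inter> T"
        using 1(4) 2(4) smooth_nhd_mono[of K "K \<union> K'" m "max m m'" "V \<inter> V'" V A f]
          smooth_nhd_mono[of K' "K \<union> K'" m' "max m m'" "V \<inter> V'" V' A f] by auto
      then show "\<exists>K m V. compact K \<and> openin (atop A) V \<and> \<zero>\<^bsub>A\<^esub> \<in> V \<and>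
            smooth_nhd A f K m V \<subseteq> S \<inter> T"
        using 1 2 by (meson IntI compact_Un openin_Int)
    qed
  next
    fix \<K> assume K: "\<forall>S\<in>\<K>. ?P S"
    show "\<Union>\<K> \<subseteq> smooth_curves A" using K by blast
    show "\<forall>f\<in>\<Union>\<K>. \<exists>K m V. compact K \<and> openin (atop A) V \<and> \<zero>\<^bsub>A\<^esub> \<in> V \<and>
            smooth_nhd A f K m V \<subseteq> \<Union>\<K>"
    proof
      fix f assume "f \<in> \<Union>\<K>"
      then obtain S where "S \<in> \<K>" "f \<in> S" by blast
      then show "\<exists>K m V. compact K \<and> openin (atop A) V \<and> \<zero>\<^bsub>A\<^esub> \<in> V \<and>
            smooth_nhd A f K m V \<subseteq> \<Union>\<K>"
        using K by (meson Sup_upper order_trans)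
    qed
  qed
  then show ?thesis
    unfolding smooth_compact_open_def by (simp add: topology_inverse')
qed

definition smooth_algebra :: "'a top_algebra \<Rightarrow> (real \<Rightarrow> 'a) top_algebra" where
  "smooth_algebra A =
     \<lparr>carrier = smooth_curves A,
      mult = (\<lambda>f g t. f t \<otimes>\<^bsub>A\<^esub> g t), one = (\<lambda>t. \<one>\<^bsub>A\<^esub>),
      zero = (\<lambda>t. \<zero>\<^bsub>A\<^esub>), add = (\<lambda>f g t. f t \<oplus>\<^bsub>A\<^esub> g t),
      smult = (\<lambda>c f t. c \<odot>\<^bsub>A\<^esub> f t), atop = smooth_compact_open A\<rparr>"


section \<open>Quotients, localization and NCP bundles\<close>

definition quotient_topology :: "'a topology \<Rightarrow> ('a \<Rightarrow> 'b) \<Rightarrow> 'b topology" where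
  "quotient_topology X p =
     topology (\<lambda>U. U \<subseteq> p ` topspace X \<and> openin X {x \<in> topspace X. p x \<in> U})"

lemma openin_quotient_topology:
  "openin (quotient_topology X p) U \<longleftrightarrow>
     U \<subseteq> p ` topspace X \<and> openin X {x \<in> topspace X. p x \<in> U}"
proof -
  have "istopology (\<lambda>U. U \<subseteq> p ` topspace X \<and> openin X {x \<in> topspace X. p x \<in> U})"
    unfolding istopology_def
  proof (intro conjI allI impI)
    fix S T
    assume "S \<subseteq> p ` topspace X \<and> openin X {x \<in> topspace X. p x \<in> S}"
      and "T \<subseteq> p ` topspace X \<and> openin X {x \<in> topspace X. p x \<in> T}"
    then have "openin X ({x \<in> topspace X. p x \<in> S} \<inter> {x \<in> topspace X. p x \<in> T})"
      and "S \<inter> T \<subseteq> p ` topspace X"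
      by auto
    moreover have "{x \<in> topspace X. p x \<in> S} \<inter> {x \<in> topspace X. p x \<in> T} =
      {x \<in> topspace X. p x \<in> S \<inter> T}" by blast
    ultimately show "S \<inter> T \<subseteq> p ` topspace X" "openin X {x \<in> topspace X. p x \<in> S \<inter> T}" by auto
  next
    fix \<K> assume K: "\<forall>S\<in>\<K>. S \<subseteq> p ` topspace X \<and> openin X {x \<in> topspace X. p x \<in> S}"
    have "{x \<in> topspace X. p x \<in> \<Union>\<K>} = (\<Union>S\<in>\<K>. {x \<in> topspace X. p x \<in> S})" by blast
    then show "openin X {x \<in> topspace X. p x \<in> \<Union>\<K>}" using K by auto
    show "\<Union>\<K> \<subseteq> p ` topspace X" using K by blast
  qed
  then show ?thesis unfolding quotient_topology_def by (simp add: topology_inverse')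
qed

text \<open>
  Operations on cosets are written as unions over representatives, as in \<^const>\<open>rcoset_mult\<close>.
  Whenever the operation is well defined, all members of the union coincide.
\<close>

definition quotient_algebra :: "'a top_algebra \<Rightarrow> 'a set \<Rightarrow> 'a set top_algebra" where
  "quotient_algebra A I =
     \<lparr>carrier = carrier (A Quot I),
      mult = mult (A Quot I), one = one (A Quot I),
      zero = zero (A Quot I), add = add (A Quot I),
      smult = (\<lambda>c X. \<Union>x\<in>X. I +>\<^bsub>A\<^esub> (c \<odot>\<^bsub>A\<^esub> x)),
      atop = quotient_topology (atop A) (\<lambda>x. I +>\<^bsub>A\<^esub> x)\<rparr>"

definition localization_ideal :: "'a top_algebra \<Rightarrow> 'a \<Rightarrow> (real \<Rightarrow> 'a) set" where
  "localization_ideal A z =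
     smooth_compact_open A closure_of
       (Idl\<^bsub>smooth_algebra A\<^esub> {\<lambda>t. \<one>\<^bsub>A\<^esub> \<ominus>\<^bsub>A\<^esub> complex_of_real t \<odot>\<^bsub>A\<^esub> z})"

definition localization :: "'a top_algebra \<Rightarrow> 'a \<Rightarrow> (real \<Rightarrow> 'a) set top_algebra" where
  "localization A z = quotient_algebra (smooth_algebra A) (localization_ideal A z)"

definition localized_action ::
  "'a top_algebra \<Rightarrow> 'a \<Rightarrow> ('g \<Rightarrow> 'a \<Rightarrow> 'a) \<Rightarrow> 'g \<Rightarrow> (real \<Rightarrow> 'a) set \<Rightarrow> (real \<Rightarrow> 'a) set" where
  "localized_action A z \<alpha> g X =
     (\<Union>f\<in>X. localization_ideal A z +>\<^bsub>smooth_algebra A\<^esub> (\<alpha> g \<circ> f))"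

definition center :: "'a top_algebra \<Rightarrow> 'a set" where
  "center A = {z \<in> carrier A. \<forall>a\<in>carrier A. z \<otimes>\<^bsub>A\<^esub> a = a \<otimes>\<^bsub>A\<^esub> z}"

definition fixed_center :: "'a top_algebra \<Rightarrow> 'g top_group \<Rightarrow> ('g \<Rightarrow> 'a \<Rightarrow> 'a) \<Rightarrow> 'a set" where
  "fixed_center A G \<alpha> = center A \<inter> fixed_points A G \<alpha>"

text \<open>
  Nonzero algebra homomorphisms from a subalgebra \<open>Z\<close> to \<open>\<complex>\<close>. No continuity is required; values
  outside \<open>Z\<close> are irrelevant.
\<close>

definition spectrum :: "'a top_algebra \<Rightarrow> 'a set \<Rightarrow> ('a \<Rightarrow> complex) set" where
  "spectrum A Z =
     {\<xi>. (\<forall>x\<in>Z. \<forall>y\<in>Z. \<xi> (x \<oplus>\<^bsub>A\<^esub> y) = \<xi> x + \<xi> y \<and> \<xi> (x \<otimes>\<^bsub>A\<^esub> y) = \<xi> x * \<xi> y) \<and>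
         (\<forall>c. \<forall>x\<in>Z. \<xi> (c \<odot>\<^bsub>A\<^esub> x) = c * \<xi> x) \<and>
         (\<exists>x\<in>Z. \<xi> x \<noteq> 0)}"

definition ncp_bundle ::
  "nat \<Rightarrow> nat list \<Rightarrow> ('g \<Rightarrow> (nat \<Rightarrow> complex) \<times> (nat \<Rightarrow> complex)) \<Rightarrow>
   'a top_algebra \<Rightarrow> 'g top_group \<Rightarrow> ('g \<Rightarrow> 'a \<Rightarrow> 'a) \<Rightarrow> bool" where
  "ncp_bundle n ns \<Phi> A G \<alpha> \<longleftrightarrow>
     dynamical_system A G \<alpha> \<and>
     (\<forall>\<xi>\<in>spectrum A (fixed_center A G \<alpha>). \<exists>z\<in>fixed_center A G \<alpha>.
        \<xi> z \<noteq> 0 \<and>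
        trivial_ncp_bundle n ns \<Phi> (localization A z) G (localized_action A z \<alpha>))"

end

theory Submission
  imports Defs
begin

text \<open>
  The witness for the localization is \<open>z = 1\<close> for every \<open>\<xi>\<close>: the unit is central and fixed by \<open>G\<close>,
  and a nonzero multiplicative functional cannot vanish on it. So it suffices that the localization
  of a trivial bundle at \<open>1\<close> is again a trivial bundle, and the reason is that inverting \<open>1\<close>
  changes nothing: the evaluation \<open>f \<mapsto> f 1\<close> induces an isomorphism from
  \<open>C\<^sup>\<infinity>(\<real>, A) / I\<^sub>1\<close> onto \<open>A\<close> that is compatible with topologies and actions, and trivial bundles
  are invariant under such isomorphisms (\<open>trivial_ncp_bundle_transport\<close>).

  Two facts make the evaluation an isomorphism. Its kernel is \<open>I\<^sub>1\<close> (\<open>localization_ideal_one\<close>): the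
  kernel is a closed ideal that contains the generator \<open>t \<mapsto> 1 - t\<close>, and conversely Hadamard's
  lemma (\<open>smooth_divide_linear\<close>) factors every smooth curve vanishing at \<open>1\<close> as \<open>(t - 1) g t\<close>
  with \<open>g\<close> smooth, so that the kernel already equals the ideal before taking closures. And
  the evaluation is a quotient map: it is continuous, and open because constant curves can be added
  (\<open>openin_evaluation_image\<close>). The quotient topology is then that of \<open>A\<close>
  (\<open>homeomorphic_map_fibre\<close>), so the continuity of the operations and of the action on the
  localization is inherited from \<open>A\<close>.

  The analytic core is Hadamard's lemma. As \<open>A\<close> need not be complete, a continuous curve
  need not have an integral. Instead the derivatives of the quotient are written down explicitly,
  and their differentiability at the zero is obtained from a mean value theorem for convex
  neighbourhoods (\<open>mean_value_disc\<close>), which follows from differentiability by bisection.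
\<close>

section \<open>Scalars and limits in a locally convex algebra\<close>

lemma limitin_binop:
  assumes "continuous_map (prod_topology X Y) Z (\<lambda>(x, y). op x y)"
    and "limitin X f a F" "limitin Y g b F"
  shows "limitin Z (\<lambda>s. op (f s) (g s)) (op a b) F"
proof -
  have "limitin (prod_topology X Y) (\<lambda>s. (f s, g s)) (a, b) F"
    using assms(2,3) by (simp add: limitin_pairwise o_def)
  from continuous_map_limit[OF assms(1) this] show ?thesis by (simp add: o_def)
qed

locale lc_algebra =
  fixes A :: "'a top_algebra" (structure)
  assumes locally_convex: "locally_convex_algebra A"
begin

sublocale ring A
  using locally_convex by (simp add: locally_convex_algebra_def complex_algebra_def)

lemma module_A: "module complex_ring A"
  using locally_convex by (simp add: locally_convex_algebra_def complex_algebra_def)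

lemma topspace_A [simp]: "topspace (atop A) = carrier A"
  and Hausdorff_A: "Hausdorff_space (atop A)"
  and continuous_add: "continuous_map (prod_topology (atop A) (atop A)) (atop A) (\<lambda>(x, y). x \<oplus> y)"
  and continuous_smult:
    "continuous_map (prod_topology euclidean (atop A)) (atop A) (\<lambda>(c, x). c \<odot> x)"
  and continuous_mult: "continuous_map (prod_topology (atop A) (atop A)) (atop A) (\<lambda>(x, y). x \<otimes> y)"
  using locally_convex by (simp_all add: locally_convex_algebra_def)

lemma smult_carrier [simp]: "x \<in> carrier A \<Longrightarrow> c \<odot> x \<in> carrier A"
  using module.smult_closed[OF module_A, of c x] by (simp add: complex_ring_def)

lemma smult_mult_left:
    "x \<in> carrier A \<Longrightarrow> y \<in> carrier A \<Longrightarrow> (c \<odot> x) \<otimes> y = c \<odot> (x \<otimes> y)"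
  and smult_mult_right:
    "x \<in> carrier A \<Longrightarrow> y \<in> carrier A \<Longrightarrow> x \<otimes> (c \<odot> y) = c \<odot> (x \<otimes> y)"
  using locally_convex by (simp_all add: locally_convex_algebra_def complex_algebra_def)

text \<open>
  Curves have a real parameter, so calculus needs the real scalars only; keeping them as a constant
  of its own stops the simplifier from moving the coercion \<^const>\<open>complex_of_real\<close> around.
\<close>

definition scale :: "real \<Rightarrow> 'a \<Rightarrow> 'a"  (infixr \<open>\<cdot>\<close> 75) where
  "r \<cdot> x = complex_of_real r \<odot> x"

lemma scale_carrier [simp]: "x \<in> carrier A \<Longrightarrow> r \<cdot> x \<in> carrier A"
  by (simp add: scale_def)

lemma scale_add_right: "x \<in> carrier A \<Longrightarrow> y \<in> carrier A \<Longrightarrow> r \<cdot> (x \<oplus> y) = r \<cdot> x \<oplus> r \<cdot> y"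
  using module.smult_r_distr[OF module_A, of "complex_of_real r" x y]
  by (simp add: complex_ring_def scale_def)

lemma scale_add_left: "x \<in> carrier A \<Longrightarrow> (r + s) \<cdot> x = r \<cdot> x \<oplus> s \<cdot> x"
  using module.smult_l_distr[OF module_A, of "complex_of_real r" "complex_of_real s" x]
  by (simp add: complex_ring_def scale_def)

lemma scale_scale [simp]: "x \<in> carrier A \<Longrightarrow> r \<cdot> s \<cdot> x = (r * s) \<cdot> x"
  using module.smult_assoc1[OF module_A, of "complex_of_real r" "complex_of_real s" x]
  by (simp add: complex_ring_def scale_def)

lemma scale_one [simp]: "x \<in> carrier A \<Longrightarrow> 1 \<cdot> x = x"
  using module.smult_one[OF module_A, of x] by (simp add: complex_ring_def scale_def)

lemma scale_zero_left [simp]: "x \<in> carrier A \<Longrightarrow> 0 \<cdot> x = \<zero>"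
  using module.smult_l_null[OF module_A, of x] by (simp add: complex_ring_def scale_def)

lemma scale_zero_right [simp]: "r \<cdot> \<zero> = \<zero>"
  using module.smult_r_null[OF module_A, of "complex_of_real r"]
  by (simp add: complex_ring_def scale_def)

lemma scale_minus_left: "x \<in> carrier A \<Longrightarrow> (- r) \<cdot> x = \<ominus> (r \<cdot> x)"
  using scale_add_left[of x "- r" r] by (intro minus_equality[symmetric]) auto

lemma scale_minus_right: "x \<in> carrier A \<Longrightarrow> r \<cdot> (\<ominus> x) = \<ominus> (r \<cdot> x)"
  using scale_add_right[of "\<ominus> x" x r] by (intro minus_equality[symmetric]) (auto simp: l_neg)

lemma minus_eq_scale: "x \<in> carrier A \<Longrightarrow> y \<in> carrier A \<Longrightarrow> x \<ominus> y = x \<oplus> (- 1) \<cdot> y"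
  by (simp add: scale_minus_left a_minus_def)

lemma scale_diff: "x \<in> carrier A \<Longrightarrow> y \<in> carrier A \<Longrightarrow> r \<cdot> (x \<ominus> y) = r \<cdot> x \<ominus> r \<cdot> y"
  by (simp add: a_minus_def scale_add_right scale_minus_right)

lemma scale_mult_left: "x \<in> carrier A \<Longrightarrow> y \<in> carrier A \<Longrightarrow> (r \<cdot> x) \<otimes> y = r \<cdot> (x \<otimes> y)"
  and scale_mult_right: "x \<in> carrier A \<Longrightarrow> y \<in> carrier A \<Longrightarrow> x \<otimes> (r \<cdot> y) = r \<cdot> (x \<otimes> y)"
  by (simp_all add: scale_def smult_mult_left smult_mult_right)

lemma diff_swap:
  assumes "x \<in> carrier A" "y \<in> carrier A"
  shows "r \<cdot> (x \<ominus> y) = (- r) \<cdot> (y \<ominus> x)"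
  using assms by (simp add: scale_diff scale_minus_left a_minus_def minus_add a_comm scale_add_right scale_minus_right)

lemma limitin_add:
  "limitin (atop A) f a F \<Longrightarrow> limitin (atop A) g b F \<Longrightarrow> limitin (atop A) (\<lambda>s. f s \<oplus> g s) (a \<oplus> b) F"
  by (rule limitin_binop[OF continuous_add])

lemma limitin_mult:
  "limitin (atop A) f a F \<Longrightarrow> limitin (atop A) g b F \<Longrightarrow> limitin (atop A) (\<lambda>s. f s \<otimes> g s) (a \<otimes> b) F"
  by (rule limitin_binop[OF continuous_mult])

lemma limitin_scale:
  assumes "(u \<longlongrightarrow> r) F" "limitin (atop A) f a F"
  shows "limitin (atop A) (\<lambda>s. u s \<cdot> f s) (r \<cdot> a) F"
  unfolding scale_def
  by (rule limitin_binop[OF continuous_smult])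
     (use assms in \<open>auto intro: tendsto_of_real\<close>)

lemma continuous_translation:
  assumes "a \<in> carrier A"
  shows "continuous_map (atop A) (atop A) (\<lambda>x. x \<oplus> a)"
proof -
  have "continuous_map (atop A) (prod_topology (atop A) (atop A)) (\<lambda>x. (x, a))"
    using assms by (simp add: continuous_map_pairwise o_def)
  from continuous_map_compose[OF this continuous_add] show ?thesis by (simp add: o_def)
qed

lemma continuous_scale: "continuous_map (atop A) (atop A) (\<lambda>x. r \<cdot> x)"
proof -
  have "continuous_map (atop A) (prod_topology euclidean (atop A)) (\<lambda>x. (complex_of_real r, x))"
    by (simp add: continuous_map_pairwise o_def)
  from continuous_map_compose[OF this continuous_smult] show ?thesis
    by (simp add: o_def scale_def)
qed

lemma openin_translate:
  assumes "openin (atop A) W" "a \<in> carrier A"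
  shows "openin (atop A) {x \<in> carrier A. x \<oplus> a \<in> W}"
  using openin_continuous_map_preimage[OF continuous_translation[OF assms(2)] assms(1)] by simp

definition disc :: "'a set \<Rightarrow> bool" where
  "disc V \<longleftrightarrow> openin (atop A) V \<and> \<zero> \<in> V \<and> (\<forall>x\<in>V. \<forall>r. \<bar>r\<bar> \<le> 1 \<longrightarrow> r \<cdot> x \<in> V) \<and>
     (\<forall>x\<in>V. \<forall>y\<in>V. \<forall>r\<in>{0..1}. (1 - r) \<cdot> x \<oplus> r \<cdot> y \<in> V)"

text \<open>
  A convex neighbourhood \<open>W\<close> of zero is made symmetric by intersecting it with \<open>-W\<close>. Convexity
  and symmetry together give closure under all real scalars of modulus at most one.
\<close>

lemma disc_base:
  assumes "openin (atop A) U" "\<zero> \<in> U"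
  obtains V where "disc V" "V \<subseteq> U"
proof -
  obtain W where W: "openin (atop A) W" "\<zero> \<in> W" "W \<subseteq> U"
    and conv: "\<And>x y r. x \<in> W \<Longrightarrow> y \<in> W \<Longrightarrow> r \<in> {0..1} \<Longrightarrow> (1 - r) \<cdot> x \<oplus> r \<cdot> y \<in> W"
    using locally_convex assms unfolding locally_convex_algebra_def scale_def by (metis (no_types))
  have Wc [simp]: "x \<in> W \<Longrightarrow> x \<in> carrier A" for x
    using openin_subset[OF W(1)] by auto
  define V where "V = W \<inter> {x \<in> carrier A. (-1) \<cdot> x \<in> W}"
  have "openin (atop A) V"
    unfolding V_def using openin_continuous_map_preimage[OF continuous_scale W(1), of "-1"] W(1)
    by (intro openin_Int) auto
  moreover have "\<zero> \<in> V" using W by (simp add: V_def)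
  moreover have VC: "(1 - r) \<cdot> x \<oplus> r \<cdot> y \<in> V" if "x \<in> V" "y \<in> V" "r \<in> {0..1}" for x y r
  proof -
    have "(-1) \<cdot> ((1 - r) \<cdot> x \<oplus> r \<cdot> y) = (1 - r) \<cdot> (-1) \<cdot> x \<oplus> r \<cdot> (-1) \<cdot> y"
      using that by (simp add: V_def scale_add_right)
    with conv[of x y r] conv[of "(-1) \<cdot> x" "(-1) \<cdot> y" r] that show ?thesis
      by (auto simp: V_def)
  qed
  moreover have "r \<cdot> x \<in> V" if x: "x \<in> V" and r: "\<bar>r\<bar> \<le> 1" for x r
  proof -
    have xc [simp]: "x \<in> carrier A" using x by (simp add: V_def)
    have neg: "(-1) \<cdot> x \<in> V" using x by (simp add: V_def)
    show ?thesis
    proof (cases "r \<ge> 0")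
      case True
      with VC[of \<zero> x r] x r \<open>\<zero> \<in> V\<close> show ?thesis by simp
    next
      case False
      with VC[of \<zero> "(-1) \<cdot> x" "- r"] neg r \<open>\<zero> \<in> V\<close> show ?thesis by simp
    qed
  qed
  ultimately have "disc V" by (simp add: disc_def)
  with W(3) that show thesis by (auto simp: V_def)
qed

lemma limitin_iff_disc:
  assumes "\<And>s. f s \<in> carrier A" "l \<in> carrier A"
  shows "limitin (atop A) f l F \<longleftrightarrow> (\<forall>V. disc V \<longrightarrow> (\<forall>\<^sub>F s in F. f s \<ominus> l \<in> V))"
proof
  assume lim: "limitin (atop A) f l F"
  show "\<forall>V. disc V \<longrightarrow> (\<forall>\<^sub>F s in F. f s \<ominus> l \<in> V)"
  proof (intro allI impI)
    fix V assume V: "disc V"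
    have "\<forall>\<^sub>F s in F. f s \<in> {x \<in> carrier A. x \<oplus> (\<ominus> l) \<in> V}"
      using lim V assms openin_translate[of V "\<ominus> l"]
      by (intro limitinD) (auto simp: disc_def r_neg)
    then show "\<forall>\<^sub>F s in F. f s \<ominus> l \<in> V" by (simp add: a_minus_def eventually_mono)
  qed
next
  assume *: "\<forall>V. disc V \<longrightarrow> (\<forall>\<^sub>F s in F. f s \<ominus> l \<in> V)"
  show "limitin (atop A) f l F"
    unfolding limitin_def
  proof (intro conjI allI impI)
    show "l \<in> topspace (atop A)" using assms by simp
    fix U assume U: "openin (atop A) U \<and> l \<in> U"
    have "openin (atop A) {x \<in> carrier A. x \<oplus> l \<in> U}" "\<zero> \<in> {x \<in> carrier A. x \<oplus> l \<in> U}"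
      using U assms openin_translate by auto
    then obtain V where V: "disc V" "V \<subseteq> {x \<in> carrier A. x \<oplus> l \<in> U}" by (rule disc_base)
    have eq: "(f s \<ominus> l) \<oplus> l = f s" for s
      using assms by (simp add: a_minus_def a_assoc l_neg)
    show "\<forall>\<^sub>F s in F. f s \<in> U"
      using *[rule_format, OF V(1)] by eventually_elim (use V(2) eq in force)
  qed
qed

end


section \<open>Differential calculus of curves\<close>

context lc_algebra
begin

lemma has_curve_deriv_scale_iff:
  "has_curve_deriv A f l t \<longleftrightarrow>
     limitin (atop A) (\<lambda>h. (1 / h) \<cdot> (f (t + h) \<ominus> f t)) l (at 0)"
  by (simp add: has_curve_deriv_def scale_def)

lemma has_curve_deriv_carrier: "has_curve_deriv A f l t \<Longrightarrow> l \<in> carrier A"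
  unfolding has_curve_deriv_def using limitin_topspace by fastforce

lemma has_curve_deriv_unique:
  "has_curve_deriv A f l t \<Longrightarrow> has_curve_deriv A f l' t \<Longrightarrow> l = l'"
  unfolding has_curve_deriv_def
  using limitin_Hausdorff_unique[OF _ _ _ Hausdorff_A] trivial_limit_at by blast

lemma curve_deriv_eq: "has_curve_deriv A f l t \<Longrightarrow> curve_deriv A f t = l"
  unfolding curve_deriv_def using has_curve_deriv_unique by blast

lemma has_curve_deriv_continuous:
  assumes "\<And>s. f s \<in> carrier A" "has_curve_deriv A f l t"
  shows "limitin (atop A) (\<lambda>h. f (t + h)) (f t) (at 0)"
proof -
  have "limitin (atop A) (\<lambda>h. h \<cdot> (1 / h) \<cdot> (f (t + h) \<ominus> f t) \<oplus> f t) (0 \<cdot> l \<oplus> f t) (at 0)"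
    using assms by (intro limitin_add limitin_scale)
      (auto simp: has_curve_deriv_scale_iff intro: tendsto_ident_at)
  moreover have "0 \<cdot> l \<oplus> f t = f t"
    using assms has_curve_deriv_carrier by simp
  moreover have "\<forall>\<^sub>F h in at 0. h \<cdot> (1 / h) \<cdot> (f (t + h) \<ominus> f t) \<oplus> f t = f (t + h)"
    using assms(1) by (auto simp: eventually_at_filter a_minus_def a_assoc l_neg)
  ultimately show ?thesis
    using limitin_transform_eventually by fastforce
qed

lemma has_curve_deriv_const: "x \<in> carrier A \<Longrightarrow> has_curve_deriv A (\<lambda>_. x) \<zero> t"
  by (simp add: has_curve_deriv_scale_iff a_minus_def r_neg)

lemma has_curve_deriv_add:
  assumes "\<And>s. f s \<in> carrier A" "\<And>s. g s \<in> carrier A"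
    and "has_curve_deriv A f k t" "has_curve_deriv A g l t"
  shows "has_curve_deriv A (\<lambda>s. f s \<oplus> g s) (k \<oplus> l) t"
proof -
  have "(1 / h) \<cdot> ((f (t + h) \<oplus> g (t + h)) \<ominus> (f t \<oplus> g t)) =
      (1 / h) \<cdot> (f (t + h) \<ominus> f t) \<oplus> (1 / h) \<cdot> (g (t + h) \<ominus> g t)" for h
    using assms(1,2) by (simp add: scale_add_right [symmetric] a_minus_def minus_add a_ac)
  with limitin_add[OF assms(3,4)[unfolded has_curve_deriv_scale_iff]] show ?thesis
    by (simp add: has_curve_deriv_scale_iff)
qed

lemma has_curve_deriv_mult:
  assumes f: "\<And>s. f s \<in> carrier A" and g: "\<And>s. g s \<in> carrier A"
    and "has_curve_deriv A f k t" "has_curve_deriv A g l t"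
  shows "has_curve_deriv A (\<lambda>s. f s \<otimes> g s) (k \<otimes> g t \<oplus> f t \<otimes> l) t"
proof -
  have "(1 / h) \<cdot> (f (t + h) \<otimes> g (t + h) \<ominus> f t \<otimes> g t) =
      ((1 / h) \<cdot> (f (t + h) \<ominus> f t)) \<otimes> g (t + h) \<oplus> f t \<otimes> ((1 / h) \<cdot> (g (t + h) \<ominus> g t))" for h
  proof -
    have "f (t + h) \<otimes> g (t + h) \<ominus> f t \<otimes> g t =
        (f (t + h) \<ominus> f t) \<otimes> g (t + h) \<oplus> f t \<otimes> (g (t + h) \<ominus> g t)"
      using f[of t] f[of "t + h"] g[of t] g[of "t + h"]
      by (simp add: a_minus_def l_distr r_distr l_minus r_minus a_assoc r_neg1 r_neg2)
    then show ?thesis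
      using f g by (simp add: scale_mult_left scale_mult_right scale_add_right)
  qed
  moreover have "limitin (atop A)
      (\<lambda>h. ((1 / h) \<cdot> (f (t + h) \<ominus> f t)) \<otimes> g (t + h) \<oplus> f t \<otimes> ((1 / h) \<cdot> (g (t + h) \<ominus> g t)))
      (k \<otimes> g t \<oplus> f t \<otimes> l) (at 0)"
    using assms has_curve_deriv_continuous[OF g assms(4)]
    by (intro limitin_add limitin_mult) (auto simp: has_curve_deriv_scale_iff)
  ultimately show ?thesis by (simp add: has_curve_deriv_scale_iff)
qed

lemma has_curve_deriv_real_mult:
  assumes f: "\<And>s. f s \<in> carrier A" and l: "has_curve_deriv A f l t"
    and u: "(u has_real_derivative u') (at t)"
  shows "has_curve_deriv A (\<lambda>s. u s \<cdot> f s) (u' \<cdot> f t \<oplus> u t \<cdot> l) t"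
proof -
  have "(1 / h) \<cdot> (u (t + h) \<cdot> f (t + h) \<ominus> u t \<cdot> f t) =
      ((u (t + h) - u t) / h) \<cdot> f (t + h) \<oplus> u t \<cdot> (1 / h) \<cdot> (f (t + h) \<ominus> f t)" for h
    using f[of t] f[of "t + h"]
    by (simp add: scale_diff minus_eq_scale scale_add_right scale_add_left[symmetric]
        a_assoc[symmetric] diff_divide_distrib)
  moreover have "limitin (atop A)
      (\<lambda>h. ((u (t + h) - u t) / h) \<cdot> f (t + h) \<oplus> u t \<cdot> (1 / h) \<cdot> (f (t + h) \<ominus> f t))
      (u' \<cdot> f t \<oplus> u t \<cdot> l) (at 0)"
    using u l has_curve_deriv_continuous[OF f l]
    by (intro limitin_add limitin_scale) (auto simp: has_curve_deriv_scale_iff DERIV_def)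
  ultimately show ?thesis by (simp add: has_curve_deriv_scale_iff)
qed

lemma has_curve_deriv_real_mult_const:
  assumes "x \<in> carrier A" "(u has_real_derivative u') (at t)"
  shows "has_curve_deriv A (\<lambda>s. u s \<cdot> x) (u' \<cdot> x) t"
  using has_curve_deriv_real_mult[OF _ has_curve_deriv_const, of x u u' t] assms by simp

lemma has_curve_deriv_scale:
  assumes "\<And>s. f s \<in> carrier A" "has_curve_deriv A f l t"
  shows "has_curve_deriv A (\<lambda>s. r \<cdot> f s) (r \<cdot> l) t"
  using has_curve_deriv_real_mult[OF assms, of "\<lambda>_. r" 0] assms has_curve_deriv_carrier[OF assms(2)]
  by simp

lemma has_curve_deriv_cong:
  assumes "has_curve_deriv A f l t" "\<forall>\<^sub>F s in nhds t. f s = g s"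
  shows "has_curve_deriv A g l t"
proof -
  have "\<forall>\<^sub>F h in at 0. f (t + h) = g (t + h)"
    using assms(2) unfolding eventually_nhds_metric eventually_at
    by (force simp: dist_real_def)
  moreover have "f t = g t" using assms(2) eventually_nhds_x_imp_x by fast
  ultimately have "\<forall>\<^sub>F h in at 0. (1 / h) \<cdot> (f (t + h) \<ominus> f t) = (1 / h) \<cdot> (g (t + h) \<ominus> g t)"
    by (simp add: eventually_mono)
  with assms(1) show ?thesis
    unfolding has_curve_deriv_scale_iff by (rule limitin_transform_eventually[rotated])
qed

lemma has_curve_deriv_linear:
  assumes f: "\<And>s. f s \<in> carrier A" and l: "has_curve_deriv A f l t"
    and cont: "continuous_map (atop A) (atop A) T"
    and add: "\<And>x y. x \<in> carrier A \<Longrightarrow> y \<in> carrier A \<Longrightarrow> T (x \<oplus> y) = T x \<oplus> T y"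
    and smult: "\<And>c x. x \<in> carrier A \<Longrightarrow> T (c \<odot> x) = c \<odot> T x"
  shows "has_curve_deriv A (\<lambda>s. T (f s)) (T l) t"
proof -
  have T: "x \<in> carrier A \<Longrightarrow> T x \<in> carrier A" for x
    using continuous_map_image_subset_topspace[OF cont] by auto
  have scl: "T (r \<cdot> x) = r \<cdot> T x" if "x \<in> carrier A" for r x
    using smult that by (simp add: scale_def)
  have "T ((1 / h) \<cdot> (f (t + h) \<ominus> f t)) = (1 / h) \<cdot> (T (f (t + h)) \<ominus> T (f t))" for h
    using f T by (simp add: minus_eq_scale add scl)
  with continuous_map_limit[OF cont l[unfolded has_curve_deriv_scale_iff]] show ?thesis
    by (simp add: has_curve_deriv_scale_iff o_def)
qed

text \<open>
  The property is inherited from adjacent intervals, since the difference quotient of the union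
  is a convex combination of the two given ones, and it holds on all short intervals around a
  fixed point for the same reason. Bolzano's bisection then yields it for \<open>{a..b}\<close>, without
  integrals and hence without completeness.
\<close>

lemma mean_value_disc:
  assumes f: "\<And>s. f s \<in> carrier A" and "a < b" and V: "disc V"
    and deriv: "\<And>s. a \<le> s \<Longrightarrow> s \<le> b \<Longrightarrow> \<exists>l\<in>V. has_curve_deriv A f l s"
  shows "(1 / (b - a)) \<cdot> (f b \<ominus> f a) \<in> V"
proof -
  define Q where "Q x y = (1 / (y - x)) \<cdot> (f y \<ominus> f x)" for x y
  have Qc: "Q x y \<in> carrier A" for x y using f by (simp add: Q_def)
  have combine: "Q x z \<in> V" if "Q x y \<in> V" "Q y z \<in> V" "x < y" "y < z" for x y z
  proof -
    define r where "r = (z - y) / (z - x)"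
    have r: "r \<in> {0..1}" and r1: "1 - r = (y - x) / (z - x)"
      using that by (auto simp: r_def field_simps)
    have "(1 - r) \<cdot> Q x y \<oplus> r \<cdot> Q y z =
        (1 / (z - x)) \<cdot> (f y \<ominus> f x) \<oplus> (1 / (z - x)) \<cdot> (f z \<ominus> f y)"
      using that f unfolding r1 Q_def by (simp add: r_def)
    also have "\<dots> = Q x z"
    proof -
      have "(f y \<ominus> f x) \<oplus> (f z \<ominus> f y) = (f z \<ominus> f y) \<oplus> (f y \<ominus> f x)"
        using f by (simp add: a_comm)
      also have "\<dots> = f z \<ominus> f x"
        using f[of x] f[of y] f[of z] by (simp add: a_minus_def a_assoc r_neg1)
      finally show ?thesis using f by (simp add: Q_def scale_add_right[symmetric])
    qed
    finally show ?thesis using V that(1,2) r unfolding disc_def by metis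
  qed
  have "a < b \<longrightarrow> Q a b \<in> V"
  proof (rule Bolzano[of a b "\<lambda>x y. x < y \<longrightarrow> Q x y \<in> V"])
    show "a \<le> b" using \<open>a < b\<close> by simp
    fix x y z assume "x < y \<longrightarrow> Q x y \<in> V" "y < z \<longrightarrow> Q y z \<in> V" "x \<le> y" "y \<le> z"
    then show "x < z \<longrightarrow> Q x z \<in> V" using combine[of x y z] by (cases "x = y"; cases "y = z") auto
  next
    fix s assume "a \<le> s" "s \<le> b"
    then obtain l where l: "l \<in> V" "has_curve_deriv A f l s" using deriv by blast
    then have "\<forall>\<^sub>F h in at 0. (1 / h) \<cdot> (f (s + h) \<ominus> f s) \<in> V"
      using V by (auto simp: has_curve_deriv_scale_iff disc_def dest: limitinD)
    then obtain d where d: "d > 0"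
      and dV: "\<And>h. h \<noteq> 0 \<Longrightarrow> \<bar>h\<bar> < d \<Longrightarrow> (1 / h) \<cdot> (f (s + h) \<ominus> f s) \<in> V"
      by (auto simp: eventually_at dist_real_def)
    show "\<exists>d>0. \<forall>x y. x \<le> s \<and> s \<le> y \<and> y - x < d \<longrightarrow> (x < y \<longrightarrow> Q x y \<in> V)"
    proof (intro exI[of _ d] conjI allI impI d)
      fix x y assume xy: "x \<le> s \<and> s \<le> y \<and> y - x < d" "x < y"
      have right: "Q s y \<in> V" if "s < y" using dV[of "y - s"] that xy by (simp add: Q_def)
      have left: "Q x s \<in> V" if "x < s"
      proof -
        have "(1 / (x - s)) \<cdot> (f x \<ominus> f s) = Q x s"
          using f that by (subst diff_swap) (auto simp: Q_def minus_divide_right)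
        with dV[of "x - s"] that xy show ?thesis by simp
      qed
      show "Q x y \<in> V"
        using left right combine[of x s y] xy by (cases "x = s"; cases "s = y") auto
    qed
  qed
  with \<open>a < b\<close> show ?thesis by (simp add: Q_def)
qed

end


section \<open>Smooth curves\<close>

context lc_algebra
begin

lemma smooth_carrier: "f \<in> smooth_curves A \<Longrightarrow> f t \<in> carrier A"
  by (auto simp: smooth_curves_def)

lemma smooth_has_deriv:
  assumes "f \<in> smooth_curves A"
  shows "has_curve_deriv A ((curve_deriv A ^^ k) f) ((curve_deriv A ^^ Suc k) f t) t"
proof -
  obtain l where "has_curve_deriv A ((curve_deriv A ^^ k) f) l t"
    using assms unfolding smooth_curves_def by blast
  with curve_deriv_eq[OF this] show ?thesis by simp
qed

lemma smooth_funpow_carrier: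
  assumes "f \<in> smooth_curves A"
  shows "(curve_deriv A ^^ k) f t \<in> carrier A"
  using assms smooth_carrier has_curve_deriv_carrier[OF smooth_has_deriv] by (cases k) auto

lemma smooth_curve_deriv:
  assumes "f \<in> smooth_curves A"
  shows "curve_deriv A f \<in> smooth_curves A"
proof -
  have shift: "(curve_deriv A ^^ k) (curve_deriv A f) = (curve_deriv A ^^ Suc k) f" for k
    by (simp add: funpow_swap1)
  have "has_curve_deriv A ((curve_deriv A ^^ k) (curve_deriv A f))
      ((curve_deriv A ^^ Suc (Suc k)) f t) t" for k t
    unfolding shift by (rule smooth_has_deriv[OF assms])
  moreover have "range (curve_deriv A f) \<subseteq> carrier A"
    using smooth_funpow_carrier[OF assms, of 1] by auto
  ultimately show ?thesis
    unfolding smooth_curves_def mem_Collect_eq by blast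
qed

text \<open>
  This replaces formulas for higher derivatives: it suffices to exhibit a family of curves that is
  closed under differentiation. Derivatives are unique, so iterating \<^term>\<open>curve_deriv A\<close> does not
  leave the family.
\<close>

lemma smooth_coinduct:
  assumes "f \<in> S" and carr: "\<And>g t. g \<in> S \<Longrightarrow> g t \<in> carrier A"
    and deriv: "\<And>g. g \<in> S \<Longrightarrow> \<exists>g'\<in>S. \<forall>t. has_curve_deriv A g (g' t) t"
  shows "f \<in> smooth_curves A"
proof -
  have step: "curve_deriv A g \<in> S \<and> (\<forall>t. has_curve_deriv A g (curve_deriv A g t) t)"
    if "g \<in> S" for g
  proof -
    obtain g' where g': "g' \<in> S" "\<And>t. has_curve_deriv A g (g' t) t" using deriv[OF \<open>g \<in> S\<close>] by blast
    then have "curve_deriv A g = g'" using curve_deriv_eq by blast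
    with g' show ?thesis by simp
  qed
  have "(curve_deriv A ^^ k) f \<in> S" for k
    by (induction k) (use \<open>f \<in> S\<close> step in auto)
  with step carr[OF \<open>f \<in> S\<close>] show ?thesis
    unfolding smooth_curves_def by blast
qed

lemma smooth_const: "x \<in> carrier A \<Longrightarrow> (\<lambda>_. x) \<in> smooth_curves A"
proof (rule smooth_coinduct)
  let ?S = "(\<lambda>x (_ :: real). x) ` carrier A"
  show "(\<lambda>_. x) \<in> ?S" if "x \<in> carrier A" using that by blast
  fix g assume "g \<in> ?S"
  then obtain y where g: "g = (\<lambda>_. y)" and y: "y \<in> carrier A" by blast
  show "g t \<in> carrier A" for t using g y by simp
  have "\<forall>t. has_curve_deriv A g \<zero> t" using has_curve_deriv_const[OF y] by (simp add: g)
  moreover have "(\<lambda>_. \<zero>) \<in> ?S" by blast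
  ultimately show "\<exists>g'\<in>?S. \<forall>t. has_curve_deriv A g (g' t) t" by (rule bexI)
qed

lemma smooth_line:
  assumes "x \<in> carrier A" "y \<in> carrier A"
  shows "(\<lambda>t. x \<oplus> t \<cdot> y) \<in> smooth_curves A"
proof (rule smooth_coinduct)
  let ?S = "{\<lambda>t. x \<oplus> t \<cdot> y |x y. x \<in> carrier A \<and> y \<in> carrier A}"
  show "(\<lambda>t. x \<oplus> t \<cdot> y) \<in> ?S" using assms by blast
  fix g assume "g \<in> ?S"
  then obtain x y where g: "g = (\<lambda>t. x \<oplus> t \<cdot> y)" and [simp]: "x \<in> carrier A" "y \<in> carrier A"
    by blast
  show "g t \<in> carrier A" for t by (simp add: g)
  have "has_curve_deriv A g (\<zero> \<oplus> 1 \<cdot> y) t" for t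
    unfolding g by (intro has_curve_deriv_add has_curve_deriv_const has_curve_deriv_real_mult_const) auto
  then have "\<forall>t. has_curve_deriv A g (y \<oplus> t \<cdot> \<zero>) t" by simp
  moreover have "(\<lambda>t. y \<oplus> t \<cdot> \<zero>) \<in> ?S"
    using zero_closed \<open>y \<in> carrier A\<close> by blast
  ultimately show "\<exists>g'\<in>?S. \<forall>t. has_curve_deriv A g (g' t) t" by (rule bexI)
qed

lemma smooth_add:
  assumes "f \<in> smooth_curves A" "g \<in> smooth_curves A"
  shows "(\<lambda>t. f t \<oplus> g t) \<in> smooth_curves A"
proof (rule smooth_coinduct)
  let ?S = "{\<lambda>t. f t \<oplus> g t |f g. f \<in> smooth_curves A \<and> g \<in> smooth_curves A}"
  show "(\<lambda>t. f t \<oplus> g t) \<in> ?S" using assms by blast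
  fix h assume "h \<in> ?S"
  then obtain f g where h: "h = (\<lambda>t. f t \<oplus> g t)" and fg: "f \<in> smooth_curves A" "g \<in> smooth_curves A"
    by blast
  show "h t \<in> carrier A" for t using fg by (simp add: h smooth_carrier)
  have "\<forall>t. has_curve_deriv A h (curve_deriv A f t \<oplus> curve_deriv A g t) t"
    unfolding h using fg smooth_carrier smooth_has_deriv[of f 0] smooth_has_deriv[of g 0]
    by (intro allI has_curve_deriv_add) auto
  moreover have "(\<lambda>t. curve_deriv A f t \<oplus> curve_deriv A g t) \<in> ?S"
    using fg[THEN smooth_curve_deriv] by blast
  ultimately show "\<exists>h'\<in>?S. \<forall>t. has_curve_deriv A h (h' t) t" by (rule bexI)
qed

text \<open>
  By the product rule the derivative of a product is a sum of two products, so the family to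
  which coinduction is applied has to be closed under sums.
\<close>

inductive_set prod_sums :: "(real \<Rightarrow> 'a) set" where
  prod: "f \<in> smooth_curves A \<Longrightarrow> g \<in> smooth_curves A \<Longrightarrow> (\<lambda>t. f t \<otimes> g t) \<in> prod_sums"
| sum: "f \<in> prod_sums \<Longrightarrow> g \<in> prod_sums \<Longrightarrow> (\<lambda>t. f t \<oplus> g t) \<in> prod_sums"

lemma smooth_mult:
  assumes "f \<in> smooth_curves A" "g \<in> smooth_curves A"
  shows "(\<lambda>t. f t \<otimes> g t) \<in> smooth_curves A"
proof (rule smooth_coinduct[of _ prod_sums])
  show "(\<lambda>t. f t \<otimes> g t) \<in> prod_sums" using assms by (rule prod_sums.prod)
  show carr: "h t \<in> carrier A" if "h \<in> prod_sums" for h t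
    using that by induction (auto simp: smooth_carrier)
  show "\<exists>h'\<in>prod_sums. \<forall>t. has_curve_deriv A h (h' t) t" if "h \<in> prod_sums" for h
    using that
  proof induction
    case (prod f g)
    have "\<forall>t. has_curve_deriv A (\<lambda>t. f t \<otimes> g t)
        (curve_deriv A f t \<otimes> g t \<oplus> f t \<otimes> curve_deriv A g t) t"
      using prod smooth_carrier smooth_has_deriv[of f 0] smooth_has_deriv[of g 0]
      by (intro allI has_curve_deriv_mult) auto
    moreover have "(\<lambda>t. curve_deriv A f t \<otimes> g t \<oplus> f t \<otimes> curve_deriv A g t) \<in> prod_sums"
      using prod smooth_curve_deriv by (intro prod_sums.intros)
    ultimately show ?case by (rule bexI)
  next
    case (sum f g)
    then obtain f' g' where f': "f' \<in> prod_sums" "\<And>t. has_curve_deriv A f (f' t) t"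
      and g': "g' \<in> prod_sums" "\<And>t. has_curve_deriv A g (g' t) t" by blast
    have "\<forall>t. has_curve_deriv A (\<lambda>t. f t \<oplus> g t) (f' t \<oplus> g' t) t"
      using has_curve_deriv_add[OF carr[OF sum.hyps(1)] carr[OF sum.hyps(2)] f'(2) g'(2)] by blast
    moreover have "(\<lambda>t. f' t \<oplus> g' t) \<in> prod_sums" using f'(1) g'(1) by (rule prod_sums.sum)
    ultimately show ?case by (rule bexI)
  qed
qed

lemma smooth_smult:
  assumes "f \<in> smooth_curves A"
  shows "(\<lambda>t. c \<odot> f t) \<in> smooth_curves A"
  using smooth_mult[OF smooth_const[of "c \<odot> \<one>"] assms] smooth_carrier[OF assms]
  by (simp add: smult_mult_left)

lemma smooth_scale: "f \<in> smooth_curves A \<Longrightarrow> (\<lambda>t. r \<cdot> f t) \<in> smooth_curves A"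
  unfolding scale_def by (rule smooth_smult)

lemma smooth_linear:
  assumes f: "f \<in> smooth_curves A"
    and cont: "continuous_map (atop A) (atop A) T"
    and add: "\<And>x y. x \<in> carrier A \<Longrightarrow> y \<in> carrier A \<Longrightarrow> T (x \<oplus> y) = T x \<oplus> T y"
    and smult: "\<And>c x. x \<in> carrier A \<Longrightarrow> T (c \<odot> x) = c \<odot> T x"
  shows "(\<lambda>t. T (f t)) \<in> smooth_curves A"
proof (rule smooth_coinduct)
  let ?S = "{\<lambda>t. T (f t) |f. f \<in> smooth_curves A}"
  show "(\<lambda>t. T (f t)) \<in> ?S" using f by blast
  fix h assume "h \<in> ?S"
  then obtain f where h: "h = (\<lambda>t. T (f t))" and f: "f \<in> smooth_curves A" by blast
  show "h t \<in> carrier A" for t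
    using continuous_map_image_subset_topspace[OF cont] smooth_carrier[OF f] by (auto simp: h)
  have "has_curve_deriv A f (curve_deriv A f t) t" for t
    using smooth_has_deriv[OF f, of 0] by simp
  from has_curve_deriv_linear[OF smooth_carrier[OF f] this cont add smult]
  have "\<forall>t. has_curve_deriv A h (T (curve_deriv A f t)) t"
    unfolding h by blast
  moreover have "(\<lambda>t. T (curve_deriv A f t)) \<in> ?S"
    using smooth_curve_deriv[OF f] by blast
  ultimately show "\<exists>h'\<in>?S. \<forall>t. has_curve_deriv A h (h' t) t" by (rule bexI)
qed

end


section \<open>Division of a smooth curve by a linear factor\<close>

context lc_algebra
begin

lemma DERIV_shifted_power:
  "((\<lambda>s. (s - p) ^ Suc k) has_real_derivative real (Suc k) * (s - p) ^ k) (at s)" for p s :: real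
proof -
  have "((\<lambda>s. s - p) has_real_derivative 1) (at s)" by (auto intro!: derivative_eq_intros)
  from DERIV_power_Suc[OF this, of k] show ?thesis by simp
qed

text \<open>
  Here \<open>F k\<close> stands for the \<open>k\<close>-th derivative of a curve \<open>f\<close> with \<open>f p = 0\<close>, and \<open>hadamard_quot F p k\<close>
  is going to be the \<open>k\<close>-th derivative of \<open>f t / (t - p)\<close>. Away from \<open>p\<close> it is \<open>P\<^sub>k t / (t - p)\<^bsup>k+1\<^esup>\<close>
  with a numerator \<open>P\<^sub>k\<close>, namely \<open>hadamard_rem F p k\<close>, that is differentiable at \<open>p\<close> as well; the
  recursion for \<open>P\<^sub>k\<close> is the Leibniz rule for \<open>f = (t - p) * (f / (t - p))\<close>. The value at \<open>p\<close> can be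
  read off from the Taylor expansion of \<open>f\<close>, which loses one power of \<open>t - p\<close> in the quotient.
\<close>

primrec hadamard_rem :: "(nat \<Rightarrow> real \<Rightarrow> 'a) \<Rightarrow> real \<Rightarrow> nat \<Rightarrow> real \<Rightarrow> 'a" where
  "hadamard_rem F p 0 t = F 0 t"
| "hadamard_rem F p (Suc k) t =
     (t - p) ^ Suc k \<cdot> F (Suc k) t \<ominus> real (Suc k) \<cdot> hadamard_rem F p k t"

definition hadamard_quot :: "(nat \<Rightarrow> real \<Rightarrow> 'a) \<Rightarrow> real \<Rightarrow> nat \<Rightarrow> real \<Rightarrow> 'a" where
  "hadamard_quot F p k t =
     (if t = p then (1 / real (Suc k)) \<cdot> F (Suc k) p
      else (1 / (t - p) ^ Suc k) \<cdot> hadamard_rem F p k t)"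

context
  fixes F :: "nat \<Rightarrow> real \<Rightarrow> 'a" and p :: real
  assumes F_carrier: "\<And>k t. F k t \<in> carrier A"
    and F_deriv: "\<And>k t. has_curve_deriv A (F k) (F (Suc k) t) t"
    and F_zero: "F 0 p = \<zero>"
begin

lemma hadamard_rem_carrier: "hadamard_rem F p k t \<in> carrier A"
  by (induction k) (auto simp: F_carrier)

lemma hadamard_quot_carrier: "hadamard_quot F p k t \<in> carrier A"
  by (simp add: hadamard_quot_def F_carrier hadamard_rem_carrier)

lemma hadamard_rem_zero: "hadamard_rem F p k p = \<zero>"
  by (induction k) (simp_all add: F_zero F_carrier a_minus_def)

text \<open>
  In the derivative of the recursion the two terms with \<open>F (k + 1)\<close> cancel. The result has a factor
  \<open>(t - p)\<^bsup>k\<^esup>\<close>, which is what makes \<open>P\<^sub>k\<close> vanish to order \<open>k + 1\<close> at \<open>p\<close>.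
\<close>

lemma hadamard_rem_deriv:
  "has_curve_deriv A (hadamard_rem F p k) ((t - p) ^ k \<cdot> F (Suc k) t) t"
proof (induction k)
  case 0
  have "hadamard_rem F p 0 = F 0" by (simp add: fun_eq_iff)
  then show ?case using F_deriv[of 0 t] F_carrier by simp
next
  case (Suc k)
  let ?x = "F (Suc k) t" and ?y = "F (Suc (Suc k)) t"
  have "has_curve_deriv A
      (\<lambda>t. (t - p) ^ Suc k \<cdot> F (Suc k) t \<oplus> (- real (Suc k)) \<cdot> hadamard_rem F p k t)
      (((real (Suc k) * (t - p) ^ k) \<cdot> ?x \<oplus> (t - p) ^ Suc k \<cdot> ?y)
        \<oplus> (- real (Suc k)) \<cdot> (t - p) ^ k \<cdot> ?x) t"
    by (intro has_curve_deriv_add has_curve_deriv_real_mult has_curve_deriv_scale Suc F_deriv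
          scale_carrier F_carrier hadamard_rem_carrier DERIV_shifted_power)
  moreover have "hadamard_rem F p (Suc k) =
      (\<lambda>t. (t - p) ^ Suc k \<cdot> F (Suc k) t \<oplus> (- real (Suc k)) \<cdot> hadamard_rem F p k t)"
    by (auto simp: minus_eq_scale F_carrier hadamard_rem_carrier)
  moreover have "((real (Suc k) * (t - p) ^ k) \<cdot> ?x \<oplus> (t - p) ^ Suc k \<cdot> ?y)
        \<oplus> (- real (Suc k)) \<cdot> (t - p) ^ k \<cdot> ?x = (t - p) ^ Suc k \<cdot> ?y"
  proof -
    have "((real (Suc k) * (t - p) ^ k) \<cdot> ?x \<oplus> (t - p) ^ Suc k \<cdot> ?y)
        \<oplus> (- real (Suc k)) \<cdot> (t - p) ^ k \<cdot> ?x =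
        (t - p) ^ Suc k \<cdot> ?y \<oplus> ((real (Suc k) * (t - p) ^ k) \<cdot> ?x
        \<oplus> (- real (Suc k)) \<cdot> (t - p) ^ k \<cdot> ?x)"
      by (simp add: F_carrier a_ac del: scale_scale)
    also have "\<dots> = (t - p) ^ Suc k \<cdot> ?y"
      by (simp add: F_carrier scale_add_left[symmetric] del: of_nat_Suc)
    finally show ?thesis .
  qed
  ultimately show ?case by simp
qed

lemma hadamard_quot_deriv_off:
  assumes "t \<noteq> p"
  shows "has_curve_deriv A (hadamard_quot F p k) (hadamard_quot F p (Suc k) t) t"
proof -
  let ?u = "\<lambda>t. 1 / (t - p) ^ Suc k" and ?P = "hadamard_rem F p k"
  have u: "(?u has_real_derivative - real (Suc k) / (t - p) ^ Suc (Suc k)) (at t)"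
  proof -
    have "(?u has_real_derivative - (real (Suc k) * (t - p) ^ k) / ((t - p) ^ Suc k)\<^sup>2) (at t)"
      using assms DERIV_divide[OF DERIV_const DERIV_shifted_power, of t p k 1]
      by (simp add: power2_eq_square del: of_nat_Suc)
    moreover have "- (real (Suc k) * (t - p) ^ k) / ((t - p) ^ Suc k)\<^sup>2 =
        - real (Suc k) / (t - p) ^ Suc (Suc k)"
      using assms by (simp add: power2_eq_square del: of_nat_Suc)
    ultimately show ?thesis by simp
  qed
  have "has_curve_deriv A (\<lambda>t. ?u t \<cdot> ?P t)
      ((- real (Suc k) / (t - p) ^ Suc (Suc k)) \<cdot> ?P t \<oplus> ?u t \<cdot> (t - p) ^ k \<cdot> F (Suc k) t) t"
    by (intro has_curve_deriv_real_mult u hadamard_rem_deriv hadamard_rem_carrier)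
  moreover have "(- real (Suc k) / (t - p) ^ Suc (Suc k)) \<cdot> ?P t \<oplus> ?u t \<cdot> (t - p) ^ k \<cdot> F (Suc k) t =
      hadamard_quot F p (Suc k) t"
  proof -
    have "?u t * (t - p) ^ k = (1 / (t - p) ^ Suc (Suc k)) * (t - p) ^ Suc k"
      using assms by simp
    then show ?thesis
      using assms
      by (simp add: hadamard_quot_def minus_eq_scale F_carrier hadamard_rem_carrier scale_add_right
          a_comm del: power_Suc)
  qed
  moreover have "\<forall>\<^sub>F s in nhds t. ?u s \<cdot> ?P s = hadamard_quot F p k s"
    using t1_space_nhds[OF assms] by (rule eventually_mono) (simp add: hadamard_quot_def)
  ultimately show ?thesis using has_curve_deriv_cong by metis
qed

text \<open>
  With \<open>c\<^sub>k = F (k + 1) p / (k + 1)\<close> for the value at \<open>p\<close> and \<open>h = t - p\<close>, the error of the difference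
  quotient is \<open>h\<^bsup>-(k+2)\<^esup>\<close> times \<open>R t = P\<^sub>k t - (t - p)\<^bsup>k+1\<^esup> c\<^sub>k - (t - p)\<^bsup>k+2\<^esup> c\<^bsub>k+1\<^esub>\<close>, where \<open>P\<^sub>k\<close> is
  \<open>hadamard_rem F p k\<close>. The derivative of \<open>R\<close> at \<open>s\<close> is \<open>(s - p)\<^bsup>k+1\<^esup>\<close> times the
  error of the difference quotient of \<open>F (k + 1)\<close> at \<open>p\<close>, so the mean value theorem bounds \<open>R\<close>.
\<close>

lemma hadamard_quot_deriv_at:
  "has_curve_deriv A (hadamard_quot F p k) (hadamard_quot F p (Suc k) p) p"
proof -
  define Y Z where "Y = F (Suc k) p" and "Z = F (Suc (Suc k)) p"
  have [simp]: "Y \<in> carrier A" "Z \<in> carrier A" by (simp_all add: Y_def Z_def F_carrier)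
  let ?P = "hadamard_rem F p k" and ?k1 = "real (Suc k)" and ?k2 = "real (Suc (Suc k))"
  have "limitin (atop A) (\<lambda>h. (1 / h) \<cdot> (hadamard_quot F p k (p + h) \<ominus> hadamard_quot F p k p))
          (hadamard_quot F p (Suc k) p) (at 0)"
  proof (subst limitin_iff_disc)
    show "\<forall>V. disc V \<longrightarrow> (\<forall>\<^sub>F h in at 0. (1 / h) \<cdot> (hadamard_quot F p k (p + h) \<ominus> hadamard_quot F p k p)
              \<ominus> hadamard_quot F p (Suc k) p \<in> V)"
    proof (intro allI impI)
      fix V assume V: "disc V"
      have "\<forall>\<^sub>F h in at 0. (1 / h) \<cdot> (F (Suc k) (p + h) \<ominus> Y) \<ominus> Z \<in> V"
        using F_deriv[of "Suc k" p] V unfolding has_curve_deriv_scale_iff Y_def Z_def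
        by (subst (asm) limitin_iff_disc) (auto simp: F_carrier)
      then obtain d where "d > 0" and
        d: "\<And>h. h \<noteq> 0 \<Longrightarrow> \<bar>h\<bar> < d \<Longrightarrow> (1 / h) \<cdot> (F (Suc k) (p + h) \<ominus> Y) \<ominus> Z \<in> V"
        by (auto simp: eventually_at dist_real_def)
      have "(1 / h) \<cdot> (hadamard_quot F p k (p + h) \<ominus> hadamard_quot F p k p)
              \<ominus> hadamard_quot F p (Suc k) p \<in> V" if h: "h \<noteq> 0" "\<bar>h\<bar> < d" for h
      proof -
        \<comment> \<open>\<open>S\<close> is \<open>R / h\<^bsup>k+1\<^esup>\<close>; this scaling bounds the factor \<open>((s - p) / h)\<^bsup>k+1\<^esup>\<close> of its derivative by one.\<close>
        define \<sigma> where "\<sigma> = 1 / h ^ Suc k"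
        define u where "u s = - (\<sigma> * (s - p) ^ Suc k / ?k1)" for s
        define v where "v s = - (\<sigma> * (s - p) ^ Suc (Suc k) / ?k2)" for s
        define S where "S s = \<sigma> \<cdot> ?P s \<oplus> (u s \<cdot> Y \<oplus> v s \<cdot> Z)" for s
        have Sc: "S s \<in> carrier A" for s by (simp add: S_def hadamard_rem_carrier)
        have S_deriv: "\<exists>l\<in>V. has_curve_deriv A S l s" if s: "\<bar>s - p\<bar> \<le> \<bar>h\<bar>" for s
        proof -
          have du: "(u has_real_derivative - (\<sigma> * (s - p) ^ k)) (at s)"
            using DERIV_cmult[OF DERIV_shifted_power, of "- (\<sigma> / ?k1)" p k s]
            by (simp add: u_def[abs_def] del: of_nat_Suc power_Suc)
          have dv: "(v has_real_derivative - (\<sigma> * (s - p) ^ Suc k)) (at s)"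
            using DERIV_cmult[OF DERIV_shifted_power, of "- (\<sigma> / ?k2)" p "Suc k" s]
            by (simp add: v_def[abs_def] del: of_nat_Suc power_Suc)
          let ?X = "F (Suc k) s"
          let ?l = "\<sigma> \<cdot> (s - p) ^ k \<cdot> ?X \<oplus> ((- (\<sigma> * (s - p) ^ k)) \<cdot> Y \<oplus> (- (\<sigma> * (s - p) ^ Suc k)) \<cdot> Z)"
          have dS: "has_curve_deriv A S ?l s"
            unfolding S_def
            by (intro has_curve_deriv_add has_curve_deriv_scale has_curve_deriv_real_mult_const du dv
                hadamard_rem_deriv hadamard_rem_carrier scale_carrier add.m_closed) auto
          have "?l \<in> V"
          proof (cases "s = p")
            case True
            have "?l = \<zero>"
              using True by (simp add: Y_def[symmetric] scale_minus_left r_neg)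
            then show ?thesis using V by (simp add: disc_def)
          next
            case False
            let ?e = "(1 / (s - p)) \<cdot> (?X \<ominus> Y) \<ominus> Z"
            have e: "?e \<in> V" using d[of "s - p"] False s h by simp
            have r: "\<bar>\<sigma> * (s - p) ^ Suc k\<bar> \<le> 1"
              using s h power_mono[OF s, of "Suc k"]
              by (simp add: \<sigma>_def abs_mult power_abs divide_simps del: power_Suc)
            have "?l = (\<sigma> * (s - p) ^ Suc k) \<cdot> ?e"
              using False
              by (simp add: scale_diff F_carrier minus_eq_scale scale_add_right a_assoc)
            with e r V show ?thesis unfolding disc_def by metis
          qed
          with dS show ?thesis by blast
        qed
        have S0: "S p = \<zero>" by (simp add: S_def u_def v_def hadamard_rem_zero)
        have "(1 / h) \<cdot> S (p + h) \<in> V"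
        proof (cases "h > 0")
          case True
          with mean_value_disc[of S p "p + h" V] Sc V S_deriv S0 show ?thesis
            by (simp add: a_minus_def)
        next
          case False
          then have "(1 / (p - (p + h))) \<cdot> (S p \<ominus> S (p + h)) \<in> V"
            using h Sc V S_deriv by (intro mean_value_disc) auto
          then show ?thesis using Sc S0 by (simp add: scale_minus_left scale_minus_right a_minus_def)
        qed
        moreover have "(1 / h) \<cdot> S (p + h) =
            (1 / h) \<cdot> (hadamard_quot F p k (p + h) \<ominus> hadamard_quot F p k p) \<ominus> hadamard_quot F p (Suc k) p"
          using h
          by (simp add: S_def hadamard_quot_def \<sigma>_def u_def v_def minus_eq_scale scale_add_right
              hadamard_rem_carrier a_assoc Y_def[symmetric] Z_def[symmetric] del: of_nat_Suc)
        ultimately show ?thesis by simp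
      qed
      with \<open>d > 0\<close> show "\<forall>\<^sub>F h in at 0. (1 / h) \<cdot> (hadamard_quot F p k (p + h) \<ominus> hadamard_quot F p k p)
              \<ominus> hadamard_quot F p (Suc k) p \<in> V"
        by (auto simp: eventually_at dist_real_def)
    qed
  qed (simp_all add: hadamard_quot_carrier)
  then show ?thesis by (simp add: has_curve_deriv_scale_iff)
qed

lemma smooth_hadamard_quot: "hadamard_quot F p k \<in> smooth_curves A"
proof (rule smooth_coinduct[of _ "range (hadamard_quot F p)"])
  show "\<exists>g'\<in>range (hadamard_quot F p). \<forall>t. has_curve_deriv A g (g' t) t"
    if "g \<in> range (hadamard_quot F p)" for g
    using that hadamard_quot_deriv_off hadamard_quot_deriv_at by (metis rangeE rangeI)
qed (auto simp: hadamard_quot_carrier)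

end

text \<open>
  Hadamard's lemma. The usual proof writes \<open>g\<close> as an integral of the derivative of \<open>f\<close> over a
  parameter and differentiates under the integral sign. The derivatives of \<open>g\<close> constructed above
  are the closed forms of these integrals, which avoids integration in a space that need not be
  complete.
\<close>

lemma smooth_divide_linear:
  assumes f: "f \<in> smooth_curves A" and "f p = \<zero>"
  obtains g where "g \<in> smooth_curves A" "\<And>t. f t = (t - p) \<cdot> g t"
proof
  let ?F = "\<lambda>k. (curve_deriv A ^^ k) f"
  let ?g = "hadamard_quot ?F p 0"
  show "?g \<in> smooth_curves A"
    using assms smooth_funpow_carrier[OF f] smooth_has_deriv[OF f]
    by (intro smooth_hadamard_quot) auto
  show "f t = (t - p) \<cdot> ?g t" for t
    using assms smooth_carrier[OF f] smooth_funpow_carrier[OF f, of 1] by (simp add: hadamard_quot_def)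
qed

end


section \<open>Transport of trivial bundles along isomorphisms\<close>

text \<open>
  Every axiom for \<open>B\<close> and \<open>\<beta>\<close> is the image of an axiom for \<open>A\<close> and \<open>\<alpha>\<close>, because operations, topology
  and action of \<open>B\<close> are conjugate under \<open>\<phi>\<close> to those of \<open>A\<close>. In particular that \<open>B\<close> is a locally
  convex algebra with a continuous action is a conclusion, which settles it for the localization.
\<close>

lemma trivial_ncp_bundle_transport:
  fixes A :: "'a top_algebra" and B :: "'b top_algebra" and G :: "'g top_group"
  assumes triv: "trivial_ncp_bundle n ns \<Phi> A G \<alpha>"
    and surj: "\<phi> ` carrier A = carrier B"
    and homeo: "homeomorphic_map (atop A) (atop B) \<phi>"
    and add: "\<And>x y. x \<in> carrier A \<Longrightarrow> y \<in> carrier A \<Longrightarrow> \<phi> (x \<oplus>\<^bsub>A\<^esub> y) = \<phi> x \<oplus>\<^bsub>B\<^esub> \<phi> y"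
    and mult: "\<And>x y. x \<in> carrier A \<Longrightarrow> y \<in> carrier A \<Longrightarrow> \<phi> (x \<otimes>\<^bsub>A\<^esub> y) = \<phi> x \<otimes>\<^bsub>B\<^esub> \<phi> y"
    and smult: "\<And>c x. x \<in> carrier A \<Longrightarrow> \<phi> (c \<odot>\<^bsub>A\<^esub> x) = c \<odot>\<^bsub>B\<^esub> \<phi> x"
    and one: "\<phi> \<one>\<^bsub>A\<^esub> = \<one>\<^bsub>B\<^esub>" and zero: "\<phi> \<zero>\<^bsub>A\<^esub> = \<zero>\<^bsub>B\<^esub>"
    and act: "\<And>g x. g \<in> carrier G \<Longrightarrow> x \<in> carrier A \<Longrightarrow> \<beta> g (\<phi> x) = \<phi> (\<alpha> g x)"
  shows "trivial_ncp_bundle n ns \<Phi> B G \<beta>"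
proof -
  have dyn: "dynamical_system A G \<alpha>" using triv by (simp add: trivial_ncp_bundle_def)
  then have lcA: "locally_convex_algebra A" by (simp add: dynamical_system_def)
  interpret A: lc_algebra A using lcA by (rule lc_algebra.intro)
  have aut: "\<alpha> g \<in> algebra_aut A" if "g \<in> carrier G" for g
    using dyn that by (simp add: dynamical_system_def)
  have actA: "\<alpha> g x \<in> carrier A" if "g \<in> carrier G" "x \<in> carrier A" for g x
    using aut[OF that(1)] that(2) by (auto simp: algebra_aut_def ring_iso_def ring_hom_def)
  have topB: "topspace (atop B) = carrier B"
    using homeomorphic_imp_surjective_map[OF homeo] surj by simp
  obtain \<psi> where "homeomorphic_maps (atop A) (atop B) \<phi> \<psi>"
    using homeo by (auto simp: homeomorphic_map_maps)
  then have cont: "continuous_map (atop A) (atop B) \<phi>" "continuous_map (atop B) (atop A) \<psi>"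
    and \<psi>\<phi> [simp]: "\<And>x. x \<in> carrier A \<Longrightarrow> \<psi> (\<phi> x) = x"
    and \<phi>\<psi> [simp]: "\<And>y. y \<in> carrier B \<Longrightarrow> \<phi> (\<psi> y) = y"
    using topB by (auto simp: homeomorphic_maps_def)
  have \<phi>_carrier [simp]: "\<phi> x \<in> carrier B" if "x \<in> carrier A" for x using surj that by blast
  have \<psi>_carrier [simp]: "\<psi> y \<in> carrier A" if "y \<in> carrier B" for y
    using continuous_map_image_subset_topspace[OF cont(2)] topB that by auto
  have add': "x \<oplus>\<^bsub>B\<^esub> y = \<phi> (\<psi> x \<oplus>\<^bsub>A\<^esub> \<psi> y)" if "x \<in> carrier B" "y \<in> carrier B" for x y
    using that by (simp add: add)
  have mult': "x \<otimes>\<^bsub>B\<^esub> y = \<phi> (\<psi> x \<otimes>\<^bsub>A\<^esub> \<psi> y)" if "x \<in> carrier B" "y \<in> carrier B" for x y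
    using that by (simp add: mult)
  have smult': "c \<odot>\<^bsub>B\<^esub> x = \<phi> (c \<odot>\<^bsub>A\<^esub> \<psi> x)" if "x \<in> carrier B" for c x
    using that by (simp add: smult)
  have act': "\<beta> g x = \<phi> (\<alpha> g (\<psi> x))" if "g \<in> carrier G" "x \<in> carrier B" for g x
    using that act[of g "\<psi> x"] by simp
  note ops = add' mult' smult' one[symmetric] zero[symmetric]
  have ringB: "ring B"
  proof (intro ringI abelian_groupI monoidI)
    show "\<exists>y\<in>carrier B. y \<oplus>\<^bsub>B\<^esub> x = \<zero>\<^bsub>B\<^esub>" if "x \<in> carrier B" for x
      using that by (intro bexI[of _ "\<phi> (\<ominus>\<^bsub>A\<^esub> \<psi> x)"]) (auto simp: ops A.l_neg)
  qed (auto simp: ops A.a_ac A.m_assoc A.l_distr A.r_distr)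
  have moduleB: "module complex_ring B"
  proof (rule moduleI)
    show "cring complex_ring" using A.module_A by (simp add: module_def)
    show "abelian_group B" using ringB by (simp add: ring_def)
    show "a \<odot>\<^bsub>B\<^esub> x \<in> carrier B" if "x \<in> carrier B" for a x using that by (simp add: ops)
    show "(a \<oplus>\<^bsub>complex_ring\<^esub> b) \<odot>\<^bsub>B\<^esub> x = a \<odot>\<^bsub>B\<^esub> x \<oplus>\<^bsub>B\<^esub> b \<odot>\<^bsub>B\<^esub> x"
      if "a \<in> carrier complex_ring" "b \<in> carrier complex_ring" "x \<in> carrier B" for a b x
      using that by (simp add: ops module.smult_l_distr[OF A.module_A])
    show "a \<odot>\<^bsub>B\<^esub> (x \<oplus>\<^bsub>B\<^esub> y) = a \<odot>\<^bsub>B\<^esub> x \<oplus>\<^bsub>B\<^esub> a \<odot>\<^bsub>B\<^esub> y"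
      if "a \<in> carrier complex_ring" "x \<in> carrier B" "y \<in> carrier B" for a x y
      using that by (simp add: ops module.smult_r_distr[OF A.module_A])
    show "(a \<otimes>\<^bsub>complex_ring\<^esub> b) \<odot>\<^bsub>B\<^esub> x = a \<odot>\<^bsub>B\<^esub> (b \<odot>\<^bsub>B\<^esub> x)"
      if "a \<in> carrier complex_ring" "b \<in> carrier complex_ring" "x \<in> carrier B" for a b x
      using that by (simp add: ops module.smult_assoc1[OF A.module_A])
    show "\<one>\<^bsub>complex_ring\<^esub> \<odot>\<^bsub>B\<^esub> x = x" if "x \<in> carrier B" for x
      using that by (simp add: ops module.smult_one[OF A.module_A])
  qed
  have algB: "complex_algebra B"
    unfolding complex_algebra_def using ringB moduleB
    by (auto simp: ops A.smult_mult_left A.smult_mult_right)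
  have cont_binop: "continuous_map (prod_topology (atop B) (atop B)) (atop B) (\<lambda>(x, y). opB x y)"
    if opA: "continuous_map (prod_topology (atop A) (atop A)) (atop A) (\<lambda>(x, y). opA x y)"
      and eq: "\<And>x y. x \<in> carrier B \<Longrightarrow> y \<in> carrier B \<Longrightarrow> opB x y = \<phi> (opA (\<psi> x) (\<psi> y))" for opA opB
  proof -
    have "continuous_map (prod_topology (atop B) (atop B)) (prod_topology (atop A) (atop A))
        (\<lambda>(x, y). (\<psi> x, \<psi> y))"
      using continuous_map_prod_top[of "atop B" "atop B" "atop A" "atop A" \<psi> \<psi>] cont(2) by simp
    from continuous_map_compose[OF continuous_map_compose[OF this opA] cont(1)]
    show ?thesis by (rule continuous_map_eq) (auto simp: topB eq)
  qed
  have lcB: "locally_convex_algebra B"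
    unfolding locally_convex_algebra_def
  proof (intro conjI allI impI)
    show "complex_algebra B" "topspace (atop B) = carrier B" by (fact algB) (fact topB)
    show "Hausdorff_space (atop B)"
      using A.Hausdorff_A homeo homeomorphic_Hausdorff_space homeomorphic_space by blast
    show "continuous_map (prod_topology (atop B) (atop B)) (atop B) (\<lambda>(x, y). x \<oplus>\<^bsub>B\<^esub> y)"
      by (rule cont_binop[OF A.continuous_add]) (rule add')
    show "continuous_map (prod_topology (atop B) (atop B)) (atop B) (\<lambda>(x, y). x \<otimes>\<^bsub>B\<^esub> y)"
      by (rule cont_binop[OF A.continuous_mult]) (rule mult')
    have "continuous_map (prod_topology euclidean (atop B)) (prod_topology euclidean (atop A))
        (\<lambda>(c :: complex, y). (c, \<psi> y))"
      using continuous_map_prod_top[of "euclidean :: complex topology" "atop B" euclidean "atop A" "\<lambda>c. c" \<psi>]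
        cont(2) by simp
    from continuous_map_compose[OF continuous_map_compose[OF this A.continuous_smult] cont(1)]
    show "continuous_map (prod_topology euclidean (atop B)) (atop B) (\<lambda>(c, x). c \<odot>\<^bsub>B\<^esub> x)"
      by (rule continuous_map_eq) (auto simp: topB smult')
  next
    fix U assume U: "openin (atop B) U \<and> \<zero>\<^bsub>B\<^esub> \<in> U"
    have "openin (atop A) {x \<in> carrier A. \<phi> x \<in> U}" "\<zero>\<^bsub>A\<^esub> \<in> {x \<in> carrier A. \<phi> x \<in> U}"
      using openin_continuous_map_preimage[OF cont(1)] U by (auto simp: zero)
    then obtain V where V: "openin (atop A) V" "\<zero>\<^bsub>A\<^esub> \<in> V" "V \<subseteq> {x \<in> carrier A. \<phi> x \<in> U}"
      and conv: "\<And>x y r. x \<in> V \<Longrightarrow> y \<in> V \<Longrightarrow> r \<in> {0..1} \<Longrightarrow>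
        complex_of_real (1 - r) \<odot>\<^bsub>A\<^esub> x \<oplus>\<^bsub>A\<^esub> complex_of_real r \<odot>\<^bsub>A\<^esub> y \<in> V"
      using lcA unfolding locally_convex_algebra_def by (metis (no_types, lifting))
    show "\<exists>V. openin (atop B) V \<and> \<zero>\<^bsub>B\<^esub> \<in> V \<and> V \<subseteq> U \<and> (\<forall>x\<in>V. \<forall>y\<in>V. \<forall>r\<in>{0..1}.
        complex_of_real (1 - r) \<odot>\<^bsub>B\<^esub> x \<oplus>\<^bsub>B\<^esub> complex_of_real r \<odot>\<^bsub>B\<^esub> y \<in> V)"
    proof (intro exI[of _ "\<phi> ` V"] conjI ballI)
      show "openin (atop B) (\<phi> ` V)"
        using homeomorphic_map_openness_eq[OF homeo] V(1,3) A.topspace_A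
        by (metis (no_types, lifting) openin_subset)
      show "\<zero>\<^bsub>B\<^esub> \<in> \<phi> ` V" using V(2) by (auto simp: zero[symmetric])
      show "\<phi> ` V \<subseteq> U" using V(3) by blast
      fix x y :: 'b and r :: real assume "x \<in> \<phi> ` V" "y \<in> \<phi> ` V" and r: "r \<in> {0..1}"
      then obtain x' y' where xy: "x = \<phi> x'" "y = \<phi> y'" "x' \<in> V" "y' \<in> V" by blast
      then have [simp]: "x' \<in> carrier A" "y' \<in> carrier A" using V(3) by auto
      have "complex_of_real (1 - r) \<odot>\<^bsub>B\<^esub> x \<oplus>\<^bsub>B\<^esub> complex_of_real r \<odot>\<^bsub>B\<^esub> y =
          \<phi> (complex_of_real (1 - r) \<odot>\<^bsub>A\<^esub> x' \<oplus>\<^bsub>A\<^esub> complex_of_real r \<odot>\<^bsub>A\<^esub> y')"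
        by (simp add: xy add smult)
      with conv[OF xy(3,4) r]
      show "complex_of_real (1 - r) \<odot>\<^bsub>B\<^esub> x \<oplus>\<^bsub>B\<^esub> complex_of_real r \<odot>\<^bsub>B\<^esub> y \<in> \<phi> ` V" by simp
    qed
  qed
  have bij\<phi>: "bij_betw \<phi> (carrier A) (carrier B)" and bij\<psi>: "bij_betw \<psi> (carrier B) (carrier A)"
    by (rule bij_betw_byWitness[of _ \<psi>]; auto) (rule bij_betw_byWitness[of _ \<phi>]; auto)
  have autB: "\<beta> g \<in> algebra_aut B" if g: "g \<in> carrier G" for g
  proof -
    have hom: "\<And>x y. x \<in> carrier A \<Longrightarrow> y \<in> carrier A \<Longrightarrow> \<alpha> g (x \<oplus>\<^bsub>A\<^esub> y) = \<alpha> g x \<oplus>\<^bsub>A\<^esub> \<alpha> g y"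
      "\<And>x y. x \<in> carrier A \<Longrightarrow> y \<in> carrier A \<Longrightarrow> \<alpha> g (x \<otimes>\<^bsub>A\<^esub> y) = \<alpha> g x \<otimes>\<^bsub>A\<^esub> \<alpha> g y"
      "\<alpha> g \<one>\<^bsub>A\<^esub> = \<one>\<^bsub>A\<^esub>" "\<And>c x. x \<in> carrier A \<Longrightarrow> \<alpha> g (c \<odot>\<^bsub>A\<^esub> x) = c \<odot>\<^bsub>A\<^esub> \<alpha> g x"
      and bij: "bij_betw (\<alpha> g) (carrier A) (carrier A)"
      using aut[OF g] by (auto simp: algebra_aut_def ring_iso_def ring_hom_def)
    have "bij_betw (\<phi> \<circ> \<alpha> g \<circ> \<psi>) (carrier B) (carrier B)"
      using bij_betw_trans[OF bij\<psi> bij_betw_trans[OF bij bij\<phi>]] by (simp add: o_assoc)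
    then have "bij_betw (\<beta> g) (carrier B) (carrier B)"
      by (rule bij_betw_cong[THEN iffD1, rotated]) (simp add: act' g)
    moreover have "\<beta> g \<in> ring_hom B B"
      using g actA by (auto simp: ring_hom_def act' ops hom)
    moreover have "\<beta> g (c \<odot>\<^bsub>B\<^esub> x) = c \<odot>\<^bsub>B\<^esub> \<beta> g x" if "x \<in> carrier B" for c x
      using that g actA by (simp add: act' ops hom)
    ultimately show ?thesis by (simp add: algebra_aut_def ring_iso_def)
  qed
  have dynB: "dynamical_system B G \<beta>"
    unfolding dynamical_system_def
  proof (intro conjI ballI)
    show "locally_convex_algebra B" by (fact lcB)
    show tg: "topological_group G" using dyn by (simp add: dynamical_system_def)
    show "\<beta> g \<in> algebra_aut B" if "g \<in> carrier G" for g using that by (rule autB)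
    show "\<beta> (g \<otimes>\<^bsub>G\<^esub> h) x = \<beta> g (\<beta> h x)"
      if gh: "g \<in> carrier G" "h \<in> carrier G" and x: "x \<in> carrier B" for g h x
    proof -
      have "g \<otimes>\<^bsub>G\<^esub> h \<in> carrier G"
        using tg gh by (auto simp: topological_group_def group_def monoid.m_closed)
      with gh x dyn actA show ?thesis by (simp add: act' dynamical_system_def)
    qed
    have topG: "topspace (gtop G) = carrier G" using tg by (simp add: topological_group_def)
    have actcont: "continuous_map (prod_topology (gtop G) (atop A)) (atop A) (\<lambda>(g, a). \<alpha> g a)"
      using dyn by (simp add: dynamical_system_def)
    have "continuous_map (prod_topology (gtop G) (atop B)) (prod_topology (gtop G) (atop A))
        (\<lambda>(g, y). (g, \<psi> y))"
      using continuous_map_prod_top[of "gtop G" "atop B" "gtop G" "atop A" "\<lambda>c. c" \<psi>] cont(2) by simp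
    from continuous_map_compose[OF continuous_map_compose[OF this actcont] cont(1)]
    show "continuous_map (prod_topology (gtop G) (atop B)) (atop B) (\<lambda>(g, a). \<beta> g a)"
      by (rule continuous_map_eq) (auto simp: topB topG act')
  qed
  have units: "\<phi> a \<in> Units B" if "a \<in> Units A" for a
  proof -
    obtain b where "a \<in> carrier A" "b \<in> carrier A" "b \<otimes>\<^bsub>A\<^esub> a = \<one>\<^bsub>A\<^esub>" "a \<otimes>\<^bsub>A\<^esub> b = \<one>\<^bsub>A\<^esub>"
      using \<open>a \<in> Units A\<close> unfolding Units_def by blast
    then show ?thesis
      by (auto simp: Units_def mult[symmetric] one[symmetric] intro!: bexI[of _ "\<phi> b"])
  qed
  have isotypic: "\<phi> a \<in> isotypic B G \<beta> \<xi>" if "a \<in> isotypic A G \<alpha> \<xi>" for a \<xi>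
    using that by (auto simp: isotypic_def act smult)
  have fixed: "\<phi> a \<in> fixed_points B G \<beta>" if "a \<in> fixed_points A G \<alpha>" for a
    using that by (auto simp: fixed_points_def act)
  have pow: "\<phi> (a [^]\<^bsub>A\<^esub> (m :: nat)) = \<phi> a [^]\<^bsub>B\<^esub> m" if "a \<in> carrier A" for a m
  proof -
    interpret B: ring B by (fact ringB)
    show ?thesis using that by (induction m) (auto simp: one mult)
  qed
  show ?thesis
    unfolding trivial_ncp_bundle_def
  proof (intro conjI allI impI)
    show "dynamical_system B G \<beta>" by (fact dynB)
    fix m
    obtain a where "a \<in> isotypic A G \<alpha> (torus_character n \<Phi> m)" "a \<in> Units A"
      using triv by (auto simp: trivial_ncp_bundle_def)
    then show "isotypic B G \<beta> (torus_character n \<Phi> m) \<inter> Units B \<noteq> {}"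
      using isotypic units by blast
  next
    fix j assume "j < length ns"
    then obtain a b where a: "a \<in> isotypic A G \<alpha> (finite_character \<Phi> j)" "a \<in> Units A"
      and b: "b \<in> fixed_points A G \<alpha>" and eq: "b [^]\<^bsub>A\<^esub> (ns ! j) = a [^]\<^bsub>A\<^esub> (ns ! j)"
      using triv unfolding trivial_ncp_bundle_def by blast
    have "\<phi> b [^]\<^bsub>B\<^esub> (ns ! j) = \<phi> a [^]\<^bsub>B\<^esub> (ns ! j)"
      using a b eq pow by (metis (no_types, lifting) fixed_points_def isotypic_def mem_Collect_eq)
    with a b isotypic units fixed
    show "\<exists>a\<in>isotypic B G \<beta> (finite_character \<Phi> j) \<inter> Units B.
        \<exists>b\<in>fixed_points B G \<beta>. b [^]\<^bsub>B\<^esub> (ns ! j) = a [^]\<^bsub>B\<^esub> (ns ! j)" by blast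
  qed
qed


section \<open>The algebra of smooth curves and its quotient\<close>

context lc_algebra
begin

lemma smooth_algebra_sel:
  "carrier (smooth_algebra A) = smooth_curves A"
  "f \<otimes>\<^bsub>smooth_algebra A\<^esub> g = (\<lambda>t. f t \<otimes> g t)"
  "\<one>\<^bsub>smooth_algebra A\<^esub> = (\<lambda>_. \<one>)"
  "\<zero>\<^bsub>smooth_algebra A\<^esub> = (\<lambda>_. \<zero>)"
  "f \<oplus>\<^bsub>smooth_algebra A\<^esub> g = (\<lambda>t. f t \<oplus> g t)"
  "c \<odot>\<^bsub>smooth_algebra A\<^esub> f = (\<lambda>t. c \<odot> f t)"
  "atop (smooth_algebra A) = smooth_compact_open A"
  by (simp_all add: smooth_algebra_def)

lemma ring_smooth_algebra: "ring (smooth_algebra A)"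
proof (intro ringI abelian_groupI monoidI, unfold smooth_algebra_sel)
  fix f g h assume f: "f \<in> smooth_curves A"
  note [simp] = smooth_carrier[OF f]
  show "(\<lambda>t. \<zero> \<oplus> f t) = f" "(\<lambda>t. \<one> \<otimes> f t) = f" "(\<lambda>t. f t \<otimes> \<one>) = f" by simp_all
  have "(\<lambda>t. (- 1) \<cdot> f t \<oplus> f t) = (\<lambda>_. \<zero>)" by (simp add: scale_minus_left l_neg)
  moreover have "(\<lambda>t. (- 1) \<cdot> f t) \<in> smooth_curves A" using f by (rule smooth_scale)
  ultimately show "\<exists>g\<in>smooth_curves A. (\<lambda>t. g t \<oplus> f t) = (\<lambda>_. \<zero>)" by (rule bexI)
  assume g: "g \<in> smooth_curves A"
  note [simp] = smooth_carrier[OF g]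
  show "(\<lambda>t. f t \<oplus> g t) \<in> smooth_curves A" "(\<lambda>t. f t \<otimes> g t) \<in> smooth_curves A"
    using f g by (rule smooth_add) (rule smooth_mult[OF f g])
  show "(\<lambda>t. f t \<oplus> g t) = (\<lambda>t. g t \<oplus> f t)" by (simp add: a_comm)
  assume h: "h \<in> smooth_curves A"
  note [simp] = smooth_carrier[OF h]
  show "(\<lambda>t. f t \<oplus> g t \<oplus> h t) = (\<lambda>t. f t \<oplus> (g t \<oplus> h t))" by (simp add: a_assoc)
  show "(\<lambda>t. f t \<otimes> g t \<otimes> h t) = (\<lambda>t. f t \<otimes> (g t \<otimes> h t))" by (simp add: m_assoc)
  show "(\<lambda>t. (f t \<oplus> g t) \<otimes> h t) = (\<lambda>t. f t \<otimes> h t \<oplus> g t \<otimes> h t)" by (simp add: l_distr)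
  show "(\<lambda>t. h t \<otimes> (f t \<oplus> g t)) = (\<lambda>t. h t \<otimes> f t \<oplus> h t \<otimes> g t)" by (simp add: r_distr)
qed (simp_all add: smooth_const)

lemma topspace_smooth_compact_open [simp]: "topspace (smooth_compact_open A) = smooth_curves A"
proof
  show "topspace (smooth_compact_open A) \<subseteq> smooth_curves A"
    using openin_topspace[of "smooth_compact_open A"] unfolding openin_smooth_compact_open by blast
  have "openin (smooth_compact_open A) (smooth_curves A)"
    unfolding openin_smooth_compact_open
  proof (intro conjI ballI exI)
    show "compact ({} :: real set)" by simp
    show "openin (atop A) (carrier A)" using openin_topspace[of "atop A"] by simp
  qed (auto simp: smooth_nhd_def)
  then show "smooth_curves A \<subseteq> topspace (smooth_compact_open A)" by (rule openin_subset)
qed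

lemma continuous_evaluation:
  "continuous_map (smooth_compact_open A) (atop A) (\<lambda>f. f p)"
  unfolding continuous_map_def topspace_smooth_compact_open topspace_A
proof (intro conjI allI impI)
  show "(\<lambda>f. f p) \<in> smooth_curves A \<rightarrow> carrier A" by (simp add: smooth_carrier)
  fix W assume W: "openin (atop A) W"
  show "openin (smooth_compact_open A) {f \<in> smooth_curves A. f p \<in> W}"
    unfolding openin_smooth_compact_open
  proof (intro conjI ballI)
    fix f assume f: "f \<in> {f \<in> smooth_curves A. f p \<in> W}"
    then have fp: "f p \<in> carrier A" by (simp add: smooth_carrier)
    let ?V = "{x \<in> carrier A. x \<oplus> f p \<in> W}"
    have "smooth_nhd A f {p} 0 ?V \<subseteq> {f \<in> smooth_curves A. f p \<in> W}"
      using fp by (auto simp: smooth_nhd_def smooth_carrier a_minus_def a_assoc l_neg)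
    moreover have "openin (atop A) ?V" "\<zero> \<in> ?V" using openin_translate[OF W fp] f fp by auto
    ultimately show "\<exists>K m V. compact K \<and> openin (atop A) V \<and> \<zero> \<in> V \<and>
        smooth_nhd A f K m V \<subseteq> {f \<in> smooth_curves A. f p \<in> W}"
      by (intro exI[of _ "{p}"] exI[of _ "0 :: nat"] exI[of _ ?V]) auto
  qed auto
qed

text \<open>
  Adding the constant \<open>v\<close> to \<open>f\<close> changes no derivative of positive order, so a basic neighbourhood
  of \<open>f\<close> contains \<open>f + v\<close> for all small \<open>v\<close>; already these curves fill a neighbourhood of \<open>f p\<close>.
\<close>

lemma openin_evaluation_image:
  assumes U: "openin (smooth_compact_open A) U"
  shows "openin (atop A) ((\<lambda>f. f p) ` U)"
proof (subst openin_subopen, intro ballI)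
  fix x assume "x \<in> (\<lambda>f. f p) ` U"
  then obtain f where f: "f \<in> U" "x = f p" by blast
  then have fs: "f \<in> smooth_curves A" using U by (auto simp: openin_smooth_compact_open)
  obtain K m V where V: "openin (atop A) V" "\<zero> \<in> V" and sub: "smooth_nhd A f K m V \<subseteq> U"
    using U f(1) unfolding openin_smooth_compact_open by blast
  let ?T = "{y \<in> carrier A. y \<oplus> \<ominus> f p \<in> V}"
  have fc: "f t \<in> carrier A" for t using fs by (rule smooth_carrier)
  have "?T \<subseteq> (\<lambda>f. f p) ` U"
  proof
    fix y assume y: "y \<in> ?T"
    define v where "v = y \<oplus> \<ominus> f p"
    have v: "v \<in> V" "v \<in> carrier A" using y fc by (auto simp: v_def)
    define g where "g = (\<lambda>t. f t \<oplus> v)"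
    have gs: "g \<in> smooth_curves A" unfolding g_def by (intro smooth_add fs smooth_const v)
    have "curve_deriv A g = curve_deriv A f"
    proof
      fix t
      have "has_curve_deriv A g (curve_deriv A f t \<oplus> \<zero>) t"
        unfolding g_def using smooth_has_deriv[OF fs, of 0] fc v
        by (intro has_curve_deriv_add has_curve_deriv_const) auto
      then show "curve_deriv A g t = curve_deriv A f t"
        using curve_deriv_eq smooth_funpow_carrier[OF fs, of 1] by simp
    qed
    then have higher: "(curve_deriv A ^^ Suc k) g = (curve_deriv A ^^ Suc k) f" for k
      by (simp add: funpow_swap1)
    have "(curve_deriv A ^^ k) g t \<ominus> (curve_deriv A ^^ k) f t \<in> V" for k t
    proof (cases k)
      case 0
      have "f t \<oplus> v \<ominus> f t = v" using fc[of t] v by (simp add: a_minus_def a_comm[of "f t" v] a_assoc r_neg)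
      with 0 v show ?thesis by (simp add: g_def)
    next
      case (Suc k')
      then show ?thesis
        using V(2) smooth_funpow_carrier[OF fs, of k t] higher[of k']
        by (simp add: a_minus_def r_neg del: funpow.simps)
    qed
    then have "g \<in> U" using sub gs by (auto simp: smooth_nhd_def)
    moreover have "g p = y"
      using y fc by (simp add: g_def v_def a_comm[of "f p"] a_assoc l_neg)
    ultimately show "y \<in> (\<lambda>f. f p) ` U" by blast
  qed
  moreover have "openin (atop A) ?T" using openin_translate[OF V(1)] fc by simp
  moreover have "x \<in> ?T" using f V(2) fc by (simp add: r_neg)
  ultimately show "\<exists>T. openin (atop A) T \<and> x \<in> T \<and> T \<subseteq> (\<lambda>f. f p) ` U" by blast
qed

definition vanishing_curves :: "real \<Rightarrow> (real \<Rightarrow> 'a) set" where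
  "vanishing_curves p = {f \<in> smooth_curves A. f p = \<zero>}"

lemma ideal_vanishing_curves: "ideal (vanishing_curves p) (smooth_algebra A)"
proof -
  have "ring_hom_ring (smooth_algebra A) A (\<lambda>f. f p)"
  proof (rule ring_hom_ringI[OF ring_smooth_algebra ring_axioms], unfold smooth_algebra_sel)
    show "f \<in> smooth_curves A \<Longrightarrow> f p \<in> carrier A" for f by (rule smooth_carrier)
  qed (rule refl)+
  from ring_hom_ring.kernel_is_ideal[OF this] show ?thesis
    by (simp only: a_kernel_def' vanishing_curves_def smooth_algebra_sel)
qed

lemma closedin_vanishing_curves: "closedin (smooth_compact_open A) (vanishing_curves p)"
proof -
  have "closedin (atop A) {\<zero>}"
    using Hausdorff_imp_t1_space[OF Hausdorff_A] by (simp add: t1_space_closedin_singleton)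
  from closedin_continuous_map_preimage[OF continuous_evaluation this]
  show ?thesis by (simp add: vanishing_curves_def)
qed

text \<open>
  The generator of the ideal vanishes at \<open>1\<close>, and vanishing at \<open>1\<close> is a closed condition. Conversely
  a smooth curve that vanishes at \<open>1\<close> is a multiple of the generator, by division by \<open>t - 1\<close>.
\<close>

lemma localization_ideal_one: "localization_ideal A \<one> = vanishing_curves 1"
proof
  interpret S: ring "smooth_algebra A" by (rule ring_smooth_algebra)
  let ?e = "\<lambda>t. \<one> \<ominus> complex_of_real t \<odot> \<one>"
  have e: "?e t = (1 - t) \<cdot> \<one>" for t
    using scale_add_left[of \<one> 1 "- t"] by (simp add: scale_minus_left a_minus_def) (simp add: scale_def)
  have "(\<lambda>t. \<one> \<oplus> t \<cdot> \<ominus> \<one>) \<in> smooth_curves A" by (intro smooth_line) auto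
  then have es: "?e \<in> smooth_curves A"
    by (simp add: scale_minus_right a_minus_def) (simp add: scale_def)
  have "?e \<in> vanishing_curves 1" using es e by (simp add: vanishing_curves_def)
  then have "Idl\<^bsub>smooth_algebra A\<^esub> {?e} \<subseteq> vanishing_curves 1"
    by (intro S.genideal_minimal ideal_vanishing_curves) simp
  then show "localization_ideal A \<one> \<subseteq> vanishing_curves 1"
    unfolding localization_ideal_def by (intro closure_of_minimal closedin_vanishing_curves)
  have carr: "carrier (smooth_algebra A) = smooth_curves A" by (simp add: smooth_algebra_sel)
  have Idl: "ideal (Idl\<^bsub>smooth_algebra A\<^esub> {?e}) (smooth_algebra A)"
    using es by (intro S.genideal_ideal) (simp add: carr)
  have "vanishing_curves 1 \<subseteq> Idl\<^bsub>smooth_algebra A\<^esub> {?e}"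
  proof
    fix f assume "f \<in> vanishing_curves 1"
    then obtain g where g: "g \<in> smooth_curves A" and fg: "\<And>t. f t = (t - 1) \<cdot> g t"
      using smooth_divide_linear[of f 1] by (auto simp: vanishing_curves_def)
    have "?e \<otimes>\<^bsub>smooth_algebra A\<^esub> (\<lambda>t. (- 1) \<cdot> g t) \<in> Idl\<^bsub>smooth_algebra A\<^esub> {?e}"
      using Idl S.genideal_self'[of ?e] es smooth_scale[OF g, of "- 1"]
      by (intro ideal.I_r_closed) (simp_all add: carr)
    moreover have "?e \<otimes>\<^bsub>smooth_algebra A\<^esub> (\<lambda>t. (- 1) \<cdot> g t) = f"
      using smooth_carrier[OF g] unfolding e by (auto simp: smooth_algebra_sel fg scale_mult_left)
    ultimately show "f \<in> Idl\<^bsub>smooth_algebra A\<^esub> {?e}" by simp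
  qed
  also have "\<dots> \<subseteq> smooth_compact_open A closure_of (Idl\<^bsub>smooth_algebra A\<^esub> {?e})"
    using ideal.Icarr[OF Idl] by (intro closure_of_subset) (auto simp: carr)
  finally show "vanishing_curves 1 \<subseteq> localization_ideal A \<one>"
    by (simp add: localization_ideal_def)
qed

text \<open>
  The cosets of the localization ideal at \<open>1\<close> are exactly these fibres of the evaluation at \<open>1\<close>. The
  map \<^term>\<open>fibre\<close> sends \<open>a\<close> to the coset of the constant curve \<open>a\<close>, and it is the inverse of the
  isomorphism from the localization to \<open>A\<close> induced by evaluation.
\<close>

definition fibre :: "'a \<Rightarrow> (real \<Rightarrow> 'a) set" where
  "fibre a = {f \<in> smooth_curves A. f 1 = a}"

lemma const_in_fibre: "a \<in> carrier A \<Longrightarrow> (\<lambda>_. a) \<in> fibre a"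
  by (simp add: fibre_def smooth_const)

lemma fibre_nonempty: "a \<in> carrier A \<Longrightarrow> fibre a \<noteq> {}"
  using const_in_fibre by blast

lemma inj_fibre: "a \<in> carrier A \<Longrightarrow> fibre a = fibre b \<Longrightarrow> a = b"
proof -
  assume "a \<in> carrier A" "fibre a = fibre b"
  then have "(\<lambda>_. a) \<in> fibre b" using const_in_fibre by metis
  then show "a = b" unfolding fibre_def by blast
qed

lemma evaluation_image: "(\<lambda>f. f p) ` {f \<in> smooth_curves A. f p \<in> W} = W \<inter> carrier A"
proof (intro equalityI subsetI)
  fix x assume x: "x \<in> W \<inter> carrier A"
  then have "(\<lambda>_. x) \<in> {f \<in> smooth_curves A. f p \<in> W}" by (simp add: smooth_const)
  from imageI[OF this, of "\<lambda>f. f p"] show "x \<in> (\<lambda>f. f p) ` {f \<in> smooth_curves A. f p \<in> W}" by simp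
next
  fix x assume "x \<in> (\<lambda>f. f p) ` {f \<in> smooth_curves A. f p \<in> W}"
  then show "x \<in> W \<inter> carrier A" using smooth_carrier by blast
qed

lemma coset_eq_fibre:
  assumes f: "f \<in> smooth_curves A"
  shows "localization_ideal A \<one> +>\<^bsub>smooth_algebra A\<^esub> f = fibre (f 1)"
proof -
  have "g \<in> (\<Union>h\<in>vanishing_curves 1. {\<lambda>t. h t \<oplus> f t})" if g: "g \<in> fibre (f 1)" for g
  proof
    have gs: "g \<in> smooth_curves A" and g1: "g 1 = f 1" using g by (auto simp: fibre_def)
    have "(\<lambda>t. g t \<oplus> (- 1) \<cdot> f t) \<in> smooth_curves A" by (intro smooth_add gs smooth_scale f)
    then show "(\<lambda>t. g t \<oplus> (- 1) \<cdot> f t) \<in> vanishing_curves 1"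
      using smooth_carrier[OF f] by (simp add: vanishing_curves_def g1 scale_minus_left r_neg)
    show "g \<in> {\<lambda>t. g t \<oplus> (- 1) \<cdot> f t \<oplus> f t}"
      using smooth_carrier[OF f] smooth_carrier[OF gs] by (simp add: scale_minus_left a_assoc l_neg)
  qed
  moreover have "(\<lambda>t. h t \<oplus> f t) \<in> fibre (f 1)" if "h \<in> vanishing_curves 1" for h
    using that f smooth_carrier[OF f] by (simp add: fibre_def vanishing_curves_def smooth_add)
  ultimately show ?thesis
    unfolding localization_ideal_one a_r_coset_def' by (auto simp: smooth_algebra_sel)
qed

lemma localization_one_carrier: "carrier (localization A \<one>) = fibre ` carrier A"
proof -
  have "carrier (localization A \<one>) =
      (\<lambda>f. localization_ideal A \<one> +>\<^bsub>smooth_algebra A\<^esub> f) ` smooth_curves A"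
    by (simp add: localization_def quotient_algebra_def FactRing_def A_RCOSETS_def' smooth_algebra_sel
        UNION_singleton_eq_range)
  also have "\<dots> = (\<lambda>f. fibre (f 1)) ` smooth_curves A"
    by (intro image_cong refl coset_eq_fibre)
  also have "\<dots> = fibre ` carrier A"
  proof -
    have "(\<lambda>f. f 1) ` smooth_curves A = carrier A"
      using evaluation_image[of 1 UNIV] by simp
    then show ?thesis by (metis image_image)
  qed
  finally show ?thesis .
qed

lemma fibre_add:
  assumes "a \<in> carrier A" "b \<in> carrier A"
  shows "fibre a \<oplus>\<^bsub>localization A \<one>\<^esub> fibre b = fibre (a \<oplus> b)"
proof -
  interpret I: ideal "vanishing_curves 1" "smooth_algebra A" by (rule ideal_vanishing_curves)
  note coset = coset_eq_fibre[unfolded localization_ideal_one]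
  have "fibre a \<oplus>\<^bsub>localization A \<one>\<^esub> fibre b =
      (vanishing_curves 1 +>\<^bsub>smooth_algebra A\<^esub> (\<lambda>_. a))
        <+>\<^bsub>smooth_algebra A\<^esub> (vanishing_curves 1 +>\<^bsub>smooth_algebra A\<^esub> (\<lambda>_. b))"
    using assms by (simp add: coset smooth_const localization_def quotient_algebra_def FactRing_def)
  also have "\<dots> = vanishing_curves 1 +>\<^bsub>smooth_algebra A\<^esub> ((\<lambda>_. a) \<oplus>\<^bsub>smooth_algebra A\<^esub> (\<lambda>_. b))"
    using assms by (intro I.a_rcos_sum) (simp_all add: smooth_algebra_sel smooth_const)
  also have "\<dots> = fibre (a \<oplus> b)"
    using assms by (simp add: smooth_algebra_sel coset smooth_const)
  finally show ?thesis .
qed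

lemma fibre_mult:
  assumes "a \<in> carrier A" "b \<in> carrier A"
  shows "fibre a \<otimes>\<^bsub>localization A \<one>\<^esub> fibre b = fibre (a \<otimes> b)"
proof -
  have "localization_ideal A \<one> +>\<^bsub>smooth_algebra A\<^esub> (f \<otimes>\<^bsub>smooth_algebra A\<^esub> g) = fibre (a \<otimes> b)"
    if "f \<in> fibre a" "g \<in> fibre b" for f g
    using that coset_eq_fibre[OF smooth_mult, of f g] by (simp add: fibre_def smooth_algebra_sel)
  then show ?thesis
    using assms
    by (simp add: localization_def quotient_algebra_def FactRing_def rcoset_mult_def
        fibre_nonempty)
qed

lemma fibre_smult:
  assumes "a \<in> carrier A"
  shows "c \<odot>\<^bsub>localization A \<one>\<^esub> fibre a = fibre (c \<odot> a)"
proof -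
  have "localization_ideal A \<one> +>\<^bsub>smooth_algebra A\<^esub> (c \<odot>\<^bsub>smooth_algebra A\<^esub> f) = fibre (c \<odot> a)"
    if "f \<in> fibre a" for f
    using that coset_eq_fibre[OF smooth_smult, of f c] by (simp add: fibre_def smooth_algebra_sel)
  then show ?thesis
    using assms by (simp add: localization_def quotient_algebra_def fibre_nonempty)
qed

lemma fibre_one: "fibre \<one> = \<one>\<^bsub>localization A \<one>\<^esub>"
  using coset_eq_fibre[OF smooth_const[OF one_closed]]
  by (simp add: localization_def quotient_algebra_def FactRing_def smooth_algebra_sel)

lemma fibre_zero: "fibre \<zero> = \<zero>\<^bsub>localization A \<one>\<^esub>"
  by (simp add: localization_def quotient_algebra_def FactRing_def localization_ideal_one
      fibre_def vanishing_curves_def)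

lemma fibre_action:
  assumes a: "a \<in> carrier A"
    and \<alpha>: "\<alpha> g \<in> algebra_aut A" "continuous_map (atop A) (atop A) (\<alpha> g)"
  shows "localized_action A \<one> \<alpha> g (fibre a) = fibre (\<alpha> g a)"
proof -
  have "localization_ideal A \<one> +>\<^bsub>smooth_algebra A\<^esub> (\<alpha> g \<circ> f) = fibre (\<alpha> g a)" if "f \<in> fibre a" for f
  proof -
    have f: "f \<in> smooth_curves A" using that by (simp add: fibre_def)
    have "\<alpha> g (x \<oplus> y) = \<alpha> g x \<oplus> \<alpha> g y" if "x \<in> carrier A" "y \<in> carrier A" for x y
      using \<alpha>(1) that by (auto simp: algebra_aut_def ring_iso_def ring_hom_def)
    moreover have "\<alpha> g (c \<odot> x) = c \<odot> \<alpha> g x" if "x \<in> carrier A" for c x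
      using \<alpha>(1) that by (auto simp: algebra_aut_def)
    ultimately have "(\<lambda>t. \<alpha> g (f t)) \<in> smooth_curves A"
      by (rule smooth_linear[OF f \<alpha>(2)])
    then have "\<alpha> g \<circ> f \<in> smooth_curves A" by (simp add: o_def)
    from coset_eq_fibre[OF this] that show ?thesis by (simp add: fibre_def)
  qed
  with a show ?thesis by (simp add: localized_action_def fibre_nonempty)
qed

text \<open>
  Through \<^term>\<open>fibre\<close>, the quotient topology becomes the one in which \<open>W\<close> is open iff the set of
  smooth curves with value at \<open>1\<close> in \<open>W\<close> is open. Evaluation is continuous, open and surjective,
  hence a quotient map, so this is the given topology of \<open>A\<close>.
\<close>

lemma homeomorphic_map_fibre: "homeomorphic_map (atop A) (atop (localization A \<one>)) fibre"
proof -
  have coset: "localization_ideal A \<one> +>\<^bsub>smooth_algebra A\<^esub> f = fibre (f 1)"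
    if "f \<in> smooth_curves A" for f
    using that by (rule coset_eq_fibre)
  have open_iff: "openin (atop (localization A \<one>)) U \<longleftrightarrow>
      U \<subseteq> fibre ` carrier A \<and> openin (smooth_compact_open A) {f \<in> smooth_curves A. fibre (f 1) \<in> U}" for U
  proof -
    have "(\<lambda>f. localization_ideal A \<one> +>\<^bsub>smooth_algebra A\<^esub> f) ` smooth_curves A = fibre ` carrier A"
      by (simp add: localization_one_carrier[symmetric] localization_def quotient_algebra_def
          FactRing_def A_RCOSETS_def' smooth_algebra_sel UNION_singleton_eq_range)
    moreover have "{f \<in> smooth_curves A. localization_ideal A \<one> +>\<^bsub>smooth_algebra A\<^esub> f \<in> U} =
        {f \<in> smooth_curves A. fibre (f 1) \<in> U}" using coset by auto
    moreover have "atop (localization A \<one>) = quotient_topology (smooth_compact_open A)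
        (\<lambda>f. localization_ideal A \<one> +>\<^bsub>smooth_algebra A\<^esub> f)"
      by (simp add: localization_def quotient_algebra_def smooth_algebra_sel)
    ultimately show ?thesis by (simp add: openin_quotient_topology)
  qed
  have image_iff: "openin (atop (localization A \<one>)) (fibre ` W) \<longleftrightarrow> openin (atop A) W"
    if W: "W \<subseteq> carrier A" for W
  proof -
    have "{f \<in> smooth_curves A. fibre (f 1) \<in> fibre ` W} = {f \<in> smooth_curves A. f 1 \<in> W}"
      using inj_fibre W smooth_carrier by blast
    moreover have "openin (atop A) W"
      if "openin (smooth_compact_open A) {f \<in> smooth_curves A. f 1 \<in> W}"
    proof -
      have "(\<lambda>f. f 1) ` {f \<in> smooth_curves A. f 1 \<in> W} = W"
        using W by (simp add: evaluation_image Int_absorb2)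
      with openin_evaluation_image[OF that, of 1] show ?thesis by simp
    qed
    moreover have "openin (smooth_compact_open A) {f \<in> smooth_curves A. f 1 \<in> W}"
      if "openin (atop A) W"
      using openin_continuous_map_preimage[OF continuous_evaluation that] by simp
    ultimately show ?thesis using W by (auto simp: open_iff)
  qed
  have top: "topspace (atop (localization A \<one>)) = fibre ` carrier A"
  proof
    show "topspace (atop (localization A \<one>)) \<subseteq> fibre ` carrier A"
      using openin_topspace open_iff by blast
    show "fibre ` carrier A \<subseteq> topspace (atop (localization A \<one>))"
      using image_iff[of "carrier A"] openin_topspace[of "atop A"] by (simp add: openin_subset)
  qed
  have "inj_on fibre (carrier A)" using inj_fibre by (intro inj_onI)
  moreover have "open_map (atop A) (atop (localization A \<one>)) fibre"
    unfolding open_map_def using image_iff openin_subset topspace_A by metis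
  moreover have "continuous_map (atop A) (atop (localization A \<one>)) fibre"
    unfolding continuous_map_def
  proof (intro conjI allI impI)
    show "fibre \<in> topspace (atop A) \<rightarrow> topspace (atop (localization A \<one>))" by (simp add: top)
    fix U assume U: "openin (atop (localization A \<one>)) U"
    then have "U \<subseteq> fibre ` carrier A" using open_iff by blast
    then have "U = fibre ` {x \<in> carrier A. fibre x \<in> U}" by blast
    with U image_iff[of "{x \<in> carrier A. fibre x \<in> U}"]
    show "openin (atop A) {x \<in> topspace (atop A). fibre x \<in> U}" by auto
  qed
  ultimately show ?thesis
    by (intro bijective_open_imp_homeomorphic_map) (simp_all add: top)
qed

end


section \<open>Trivial bundles are bundles\<close>

lemma (in lc_algebra) trivial_ncp_bundle_localization_one:
  assumes triv: "trivial_ncp_bundle n ns \<Phi> A G \<alpha>"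
  shows "trivial_ncp_bundle n ns \<Phi> (localization A \<one>) G (localized_action A \<one> \<alpha>)"
proof (rule trivial_ncp_bundle_transport[OF triv, of fibre])
  have dyn: "dynamical_system A G \<alpha>" using triv by (simp add: trivial_ncp_bundle_def)
  show "localized_action A \<one> \<alpha> g (fibre x) = fibre (\<alpha> g x)"
    if g: "g \<in> carrier G" and x: "x \<in> carrier A" for g x
  proof (rule fibre_action[OF x])
    show "\<alpha> g \<in> algebra_aut A" using dyn g by (simp add: dynamical_system_def)
    have top: "topspace (gtop G) = carrier G"
      using dyn by (simp add: dynamical_system_def topological_group_def)
    have act: "continuous_map (prod_topology (gtop G) (atop A)) (atop A) (\<lambda>(g, a). \<alpha> g a)"
      using dyn by (simp add: dynamical_system_def)
    have "continuous_map (atop A) (prod_topology (gtop G) (atop A)) (\<lambda>a. (g, a))"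
      using g top by (simp add: continuous_map_pairwise o_def)
    from continuous_map_compose[OF this act]
    show "continuous_map (atop A) (atop A) (\<alpha> g)" by (simp add: o_def)
  qed
qed (simp_all add: localization_one_carrier homeomorphic_map_fibre fibre_add fibre_mult fibre_smult
      fibre_one fibre_zero)

lemma (in lc_algebra) spectrum_one_nonzero:
  assumes "\<xi> \<in> spectrum A Z" "Z \<subseteq> carrier A" "\<one> \<in> Z"
  shows "\<xi> \<one> \<noteq> 0"
proof
  assume zero: "\<xi> \<one> = 0"
  obtain x where x: "x \<in> Z" "\<xi> x \<noteq> 0" using assms(1) by (auto simp: spectrum_def)
  have "\<xi> (x \<otimes> \<one>) = \<xi> x * \<xi> \<one>" using assms(1,3) x(1) by (simp add: spectrum_def)
  moreover have "x \<otimes> \<one> = x" using x(1) assms(2) by auto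
  ultimately show False using zero x(2) by simp
qed

lemma (in lc_algebra) one_in_fixed_center:
  assumes "dynamical_system A G \<alpha>"
  shows "\<one> \<in> fixed_center A G \<alpha>"
proof -
  have "\<alpha> g \<one> = \<one>" if "g \<in> carrier G" for g
    using assms that by (auto simp: dynamical_system_def algebra_aut_def ring_iso_def ring_hom_def)
  then show ?thesis by (simp add: fixed_center_def center_def fixed_points_def)
qed

theorem theorem9p2p1:
  fixes G :: "'g top_group" and A :: "'a top_algebra" and \<alpha> :: "'g \<Rightarrow> 'a \<Rightarrow> 'a"
    and n :: nat and ns :: "nat list" and \<Phi> :: "'g \<Rightarrow> (nat \<Rightarrow> complex) \<times> (nat \<Rightarrow> complex)"
  assumes "compact_abelian_lie_group G"
    and "standard_form n ns \<Phi> G"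
    and "trivial_ncp_bundle n ns \<Phi> A G \<alpha>"
  shows "ncp_bundle n ns \<Phi> A G \<alpha>"
proof -
  have dyn: "dynamical_system A G \<alpha>"
    using assms(3) by (simp add: trivial_ncp_bundle_def)
  interpret lc_algebra A by (rule lc_algebra.intro) (use dyn in \<open>simp add: dynamical_system_def\<close>)
  have one: "\<one>\<^bsub>A\<^esub> \<in> fixed_center A G \<alpha>" by (rule one_in_fixed_center[OF dyn])
  have "fixed_center A G \<alpha> \<subseteq> carrier A" by (auto simp: fixed_center_def center_def)
  then have "\<xi> \<one>\<^bsub>A\<^esub> \<noteq> 0" if "\<xi> \<in> spectrum A (fixed_center A G \<alpha>)" for \<xi>
    using spectrum_one_nonzero[OF that _ one] by simp
  then show ?thesis
    unfolding ncp_bundle_def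
    using dyn one trivial_ncp_bundle_localization_one[OF assms(3)] by blast
qed

end
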